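(* The function $$Z_{\mathrm{4D}}(X) = \sum_{\lambda\in\mathcal{P}}\left(\frac{\dim\lambda}{|\lambda|!}\right)^2\left(\frac{\Lambda}{\hbar}\right)^{2|\lambda|}\prod_{i=1}^\infty\frac{X-(\lambda_i-i+1)\hbar}{X-(-i+1)\hbar}$$ satisfies the difference equation $$\left((X-\hbar)\left(e^{-\hbar\, d/dX}-1\right)+\frac{\Lambda^2}{X}e^{\hbar\, d/dX}\right)Z_{\mathrm{4D}}(X)=0.$$
   Context: $\mathcal{P}$ is the set of all partitions $\lambda=(\lambda_1\ge\lambda_2\ge\cdots\ge0)$ with finitely many nonzero parts, $|\lambda|=\sum_i\lambda_i$, and $\dim\lambda$ is the number of standard Young tableaux of shape $\lambda$. The infinite product has only finitely many factors different from $1$. $e^{\pm\hbar\, d/dX}$ is the shift operator $f(X)\mapsto f(X\pm\hbar)$. $Z_{\mathrm{4D}}(X)$ is regarded as a formal power series in $\Lambda^2$ whose coefficients are rational functions of $X$ ($\hbar\neq0$ a parameter). *)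

theory Defs
  imports
    "HOL-Analysis.Infinite_Sum"
    "HOL-Computational_Algebra.Polynomial_Factorial"
    "HOL-Computational_Algebra.Formal_Power_Series"
    "HOL-Library.Groups_Big_Fun"
    "HOL-Library.FuncSet"
begin

section \<open>Partitions and standard Young tableaux\<close>

text \<open>
  A partition \<open>\<lambda>\<^sub>1 \<ge> \<lambda>\<^sub>2 \<ge> \<dots>\<close> is represented by the function \<open>l\<close> with \<open>l i = \<lambda>\<^bsub>i+1\<^esub>\<close>, i.e. parts
  are indexed from 0. Rows and columns of Young diagrams are indexed from 0 as well.
\<close>

definition partitions :: "(nat \<Rightarrow> nat) set" where
  "partitions = {l. antimono l \<and> finite {i. l i \<noteq> 0}}"

definition psize :: "(nat \<Rightarrow> nat) \<Rightarrow> nat" where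
  "psize l = (\<Sum>i | l i \<noteq> 0. l i)"

definition young_diagram :: "(nat \<Rightarrow> nat) \<Rightarrow> (nat \<times> nat) set" where
  "young_diagram l = {(i, j). j < l i}"

text \<open>Fillings are extensional, so that each tableau is counted exactly once.\<close>

definition standard_young_tableaux :: "(nat \<Rightarrow> nat) \<Rightarrow> (nat \<times> nat \<Rightarrow> nat) set" where
  "standard_young_tableaux l =
     {T \<in> extensional (young_diagram l).
        bij_betw T (young_diagram l) {1..psize l} \<and>
        (\<forall>i j j'. (i, j') \<in> young_diagram l \<longrightarrow> j < j' \<longrightarrow> T (i, j) < T (i, j')) \<and>
        (\<forall>i i' j. (i, j) \<in> young_diagram l \<longrightarrow> (i', j) \<in> young_diagram l \<longrightarrow> i < i' \<longrightarrow>
            T (i, j) < T (i', j))}"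

definition pdim :: "(nat \<Rightarrow> nat) \<Rightarrow> nat" where
  "pdim l = card (standard_young_tableaux l)"


section \<open>Rational functions and the shift operator\<close>

text \<open>The field of rational functions in \<open>X\<close> over \<open>'a\<close> is \<open>'a poly fract\<close>.\<close>

definition ratX :: "'a::field poly fract" where
  "ratX = to_fract [:0, 1:]"

definition ratconst :: "'a::field \<Rightarrow> 'a poly fract" where
  "ratconst c = to_fract [:c:]"

text \<open>
  \<open>rat_shift c\<close> is the operator \<open>f(X) \<mapsto> f(X + c)\<close>, i.e. \<open>exp (c d/dX)\<close>. It substitutes \<open>X + c\<close> in the
  numerator and the denominator; the result does not depend on the representation as a fraction,
  see \<open>rat_shift_Fract\<close>.
\<close>

definition rat_shift :: "'a::field \<Rightarrow> 'a poly fract \<Rightarrow> 'a poly fract" where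
  "rat_shift c f =
     (THE g. \<forall>p q. q \<noteq> 0 \<longrightarrow> f = Fract p q \<longrightarrow> g = Fract (pcompose p [:c, 1:]) (pcompose q [:c, 1:]))"

lemma rat_shift_Fract:
  assumes "q \<noteq> 0"
  shows "rat_shift c (Fract p q) = Fract (pcompose p [:c, 1:]) (pcompose q [:c, 1:])"
proof -
  have nz: "pcompose r [:c, 1:] \<noteq> 0" if "r \<noteq> 0" for r
    using that pcompose_eq_0[of r "[:c, 1:]"] by auto
  have "Fract (pcompose p [:c, 1:]) (pcompose q [:c, 1:]) =
        Fract (pcompose p' [:c, 1:]) (pcompose q' [:c, 1:])"
    if "q' \<noteq> 0" "Fract p q = Fract p' q'" for p' q'
  proof -
    have "p * q' = p' * q" using that assms by (simp add: eq_fract(1))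
    then show ?thesis
      unfolding eq_fract(1)[OF nz[OF assms] nz[OF that(1)]] pcompose_mult[symmetric] by simp
  qed
  then show ?thesis
    unfolding rat_shift_def using assms by (intro the_equality) blast+
qed

definition fps_rat_shift :: "'a::field \<Rightarrow> 'a poly fract fps \<Rightarrow> 'a poly fract fps" where
  "fps_rat_shift c F = Abs_fps (\<lambda>n. rat_shift c (fps_nth F n))"


section \<open>The generating function\<close>

text \<open>
  In \<open>'a poly fract fps\<close> the indeterminate \<open>fps_X\<close> plays the role of \<open>\<Lambda>\<^sup>2\<close>;
  \<open>h\<close> is the parameter hbar.
  With parts indexed from 0, the numbers \<open>\<lambda>\<^sub>i - i + 1\<close> and \<open>-i + 1\<close> (\<open>i \<ge> 1\<close>) become \<open>l i - i\<close>
  and \<open>-i\<close> (\<open>i \<ge> 0\<close>).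
\<close>

definition Z4D_factor :: "'a::field \<Rightarrow> (nat \<Rightarrow> nat) \<Rightarrow> nat \<Rightarrow> 'a poly fract" where
  "Z4D_factor h l i =
     (ratX - ratconst ((of_nat (l i) - of_nat i) * h)) / (ratX - ratconst (- of_nat i * h))"

definition Z4D_term :: "'a::field_char_0 \<Rightarrow> (nat \<Rightarrow> nat) \<Rightarrow> 'a poly fract fps" where
  "Z4D_term h l =
     fps_const (ratconst ((of_nat (pdim l) / fact (psize l))\<^sup>2 * (1 / h) ^ (2 * psize l)) *
                Prod_any (Z4D_factor h l)) * fps_X ^ psize l"

text \<open>
  The infinite sum refers to the topology of coefficientwise (eventually constant) convergence on
  formal power series. It does converge, see \<open>Z4D_has_sum\<close> below.
\<close>

definition Z4D :: "'a::field_char_0 \<Rightarrow> 'a poly fract fps" where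
  "Z4D h = (\<Sum>\<^sub>\<infinity>l\<in>partitions. Z4D_term h l)"


lemma finite_Z4D_factor_neq_1:
  assumes "l \<in> partitions"
  shows "finite {i. Z4D_factor h l i \<noteq> 1}"
proof (rule finite_subset)
  show "finite {i. l i \<noteq> 0}" using assms by (simp add: partitions_def)
  have "Z4D_factor h l i = 1" if "l i = 0" for i
  proof -
    have "ratX - ratconst (- of_nat i * h) \<noteq> 0"
      by (simp add: ratX_def ratconst_def flip: to_fract_diff)
    then show ?thesis using that by (simp add: Z4D_factor_def)
  qed
  then show "{i. Z4D_factor h l i \<noteq> 1} \<subseteq> {i. l i \<noteq> 0}" by auto
qed

lemma finite_partitions_psize: "finite {l \<in> partitions. psize l = n}"
proof (rule finite_subset)
  show "finite {l :: nat \<Rightarrow> nat. \<forall>i. (i \<in> {..<n} \<longrightarrow> l i \<in> {..n}) \<and> (i \<notin> {..<n} \<longrightarrow> l i = 0)}"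
    by (rule finite_set_of_finite_funs) auto
  have "l i \<le> n \<and> (n \<le> i \<longrightarrow> l i = 0)" if l: "l \<in> partitions" "psize l = n" for l i
  proof
    have fin: "finite {i. l i \<noteq> 0}" and anti: "antimono l"
      using l by (auto simp: partitions_def)
    show "l i \<le> n"
    proof (cases "l i = 0")
      case False
      then show ?thesis
        using member_le_sum[of i "{i. l i \<noteq> 0}" l] fin l(2) by (auto simp: psize_def)
    qed simp
    show "n \<le> i \<longrightarrow> l i = 0"
    proof (intro impI, rule ccontr)
      assume "n \<le> i" "l i \<noteq> 0"
      have "l j \<noteq> 0" if "j \<le> i" for j
        using antimonoD[OF anti that] \<open>l i \<noteq> 0\<close> by simp
      then have sub: "{..i} \<subseteq> {i. l i \<noteq> 0}" by auto
      have "Suc i = card {..i}" by simp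
      also have "\<dots> \<le> card {i. l i \<noteq> 0}" using fin sub by (rule card_mono)
      also have "\<dots> = (\<Sum>i | l i \<noteq> 0. 1)" by simp
      also have "\<dots> \<le> psize l" unfolding psize_def by (rule sum_mono) auto
      finally show False using l(2) \<open>n \<le> i\<close> by simp
    qed
  qed
  then show "{l \<in> partitions. psize l = n} \<subseteq>
      {l. \<forall>i. (i \<in> {..<n} \<longrightarrow> l i \<in> {..n}) \<and> (i \<notin> {..<n} \<longrightarrow> l i = 0)}"
    by (force simp: not_less)
qed

lemma Z4D_has_sum: "(Z4D_term h has_sum Z4D h) partitions"
proof -
  have "finite {l \<in> partitions. fps_nth (Z4D_term h l) n \<noteq> 0}" for n
    by (rule finite_subset[OF _ finite_partitions_psize[of n]])
       (auto simp: Z4D_term_def fps_X_power_mult_right_nth split: if_splits)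
  then have "(Z4D_term h has_sum
      Abs_fps (\<lambda>n. \<Sum>l | l \<in> partitions \<and> fps_nth (Z4D_term h l) n \<noteq> 0. fps_nth (Z4D_term h l) n))
      partitions"
    by (intro has_sum_fpsI) simp_all
  then show ?thesis unfolding Z4D_def by (intro has_sum_infsum) (auto simp only: summable_on_def)
qed

end

theory Submission
  imports Defs
begin

text \<open>
  Put \<open>x = X / h\<close> and \<open>A\<^sub>n(x) = \<Sum>\<^bsub>|l| = n\<^esub> (dim l / n!)\<^sup>2 F\<^sub>l(x)\<close> with
  \<open>F\<^sub>l(x) = \<Prod>\<^sub>i (x + i - l i) / (x + i)\<close>. Comparing coefficients of \<open>\<Lambda>\<^bsup>2n\<^esup>\<close>, the claim becomes
  \<open>x (x - 1) (A\<^sub>n(x) - A\<^sub>n(x - 1)) = A\<^bsub>n-1\<^esub>(x + 1)\<close>.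

  Adding a box of content \<open>c\<close> to \<open>l\<close> multiplies \<open>F\<^sub>l(x)\<close> by \<open>1 - 1 / (x - c)\<close>, and the Cauchy
  transform of the Plancherel transition measure (Kerov) is \<open>F\<^sub>l(x + 1) / (x F\<^sub>l(x))\<close>. With the
  branching rule for standard tableaux this gives \<open>(n + 1) A\<^bsub>n+1\<^esub>(x) = A\<^sub>n(x) - A\<^sub>n(x + 1) / x\<close>, from
  which the difference equation follows by induction on \<open>n\<close>. Kerov's formula is a partial fraction
  expansion once \<open>dim l\<close> is known by Frobenius' formula, which in turn follows from the branching
  rule and another partial fraction identity.
\<close>

section \<open>Partial fractions\<close>

text \<open>Partial fractions in \<open>u\<close>: the left side tends to zero at infinity and has
  simple poles at \<open>0\<close> and \<open>v\<close>, with residues \<open>- s / v\<close> and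
  \<open>(v + s) / v\<close>.\<close>

lemma shift_quotient_split:
  fixes u v s :: "'a::field"
  assumes "u \<noteq> 0" "v \<noteq> 0" "u \<noteq> v"
  shows "(u + s) / u / (u - v) = s / (- v) / u + (v + s) / v / (u - v)"
  using assms by (simp add: divide_simps) (simp add: algebra_simps)

text \<open>As a rational function of \<open>w\<close>, the product has value 1 at infinity and
  simple poles at the nodes \<open>a i\<close>, whose residues are \<open>s\<close> times the inner
  products. Induction on \<open>I\<close> keeps the argument purely algebraic. The point
  \<open>w\<close> varies because the induction hypothesis is also used at the new node.\<close>

lemma partial_fractions_shift:
  fixes a :: "'b \<Rightarrow> 'a::field"
  assumes "finite I" "inj_on a I" "w \<notin> a ` I"
  shows "(\<Prod>j\<in>I. (w + s - a j) / (w - a j)) =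
           1 + s * (\<Sum>i\<in>I. (\<Prod>j\<in>I - {i}. (a i + s - a j) / (a i - a j)) / (w - a i))"
  using assms
proof (induction I arbitrary: w rule: finite_induct)
  case (insert b I)
  let ?p = "\<lambda>i. \<Prod>j\<in>I - {i}. (a i + s - a j) / (a i - a j)"
  have ne: "a i \<noteq> a b" "w \<noteq> a i" if "i \<in> I" for i
    using insert.prems insert.hyps that by (auto simp: inj_on_def)
  have wb: "w \<noteq> a b" using insert.prems by auto
  have split: "(\<Prod>j\<in>insert b I - {i}. (a i + s - a j) / (a i - a j)) =
      (a i + s - a b) / (a i - a b) * ?p i" if "i \<in> I" for i
  proof -
    have "insert b I - {i} = insert b (I - {i})" using that insert.hyps by auto
    then show ?thesis using insert.hyps by simp
  qed
  have IHw: "(\<Prod>j\<in>I. (w + s - a j) / (w - a j)) = 1 + s * (\<Sum>i\<in>I. ?p i / (w - a i))"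
    by (rule insert.IH) (use insert.prems in auto)
  \<comment> \<open>The value at the new node \<open>a b\<close> is the product attached to the new
    pole.\<close>
  have IHb: "(\<Prod>j\<in>I. (a b + s - a j) / (a b - a j)) = 1 + s * (\<Sum>i\<in>I. ?p i / (a b - a i))"
    by (rule insert.IH) (use insert.prems ne in auto)
  have "(w + s - a b) / (w - a b) * (1 + s * (\<Sum>i\<in>I. ?p i / (w - a i))) =
        1 + s * ((1 + s * (\<Sum>i\<in>I. ?p i / (a b - a i))) / (w - a b) +
             (\<Sum>i\<in>I. (a i + s - a b) / (a i - a b) * ?p i / (w - a i)))"
  proof -
    have 1: "(w + s - a b) / (w - a b) * (?p i / (w - a i)) =
       s * ?p i / (a b - a i) / (w - a b) + (a i + s - a b) / (a i - a b) * ?p i / (w - a i)"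
      if "i \<in> I" for i
    proof -
      have nz: "w - a b \<noteq> 0" "a i - a b \<noteq> 0" "w - a b \<noteq> a i - a b" using ne[OF that] wb by auto
      have "(w + s - a b) / (w - a b) / (w - a i) =
         s / (a b - a i) / (w - a b) + (a i + s - a b) / (a i - a b) / (w - a i)"
        using shift_quotient_split[OF nz, of s] by (simp add: algebra_simps)
      then have "(w + s - a b) / (w - a b) / (w - a i) * ?p i =
         (s / (a b - a i) / (w - a b) + (a i + s - a b) / (a i - a b) / (w - a i)) * ?p i" by simp
      then show ?thesis by (simp add: distrib_right)
    qed
    have "(w + s - a b) / (w - a b) * (\<Sum>i\<in>I. ?p i / (w - a i)) =
       s * (\<Sum>i\<in>I. ?p i / (a b - a i)) / (w - a b) +
       (\<Sum>i\<in>I. (a i + s - a b) / (a i - a b) * ?p i / (w - a i))"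
      using 1 by (simp add: sum_distrib_left sum_divide_distrib flip: sum.distrib)
    moreover have "(w + s - a b) / (w - a b) = 1 + s / (w - a b)"
      using wb by (simp add: field_simps)
    moreover have "q * (1 + s * S) = 1 + s * ((1 + s * R) / v + T)"
      if "q * S = s * R / v + T" "q = 1 + s / v" for q S R T v :: 'a
    proof -
      have "q * (1 + s * S) = q + s * (q * S)" by (simp add: algebra_simps)
      also have "\<dots> = 1 + s / v + s * (s * R / v + T)" by (subst that(1)) (simp add: that(2))
      finally show ?thesis by (simp add: algebra_simps add_divide_distrib)
    qed
    ultimately show ?thesis by blast
  qed
  then show ?case using insert.hyps IHw IHb split by simp
qed simp

text \<open>These are the coefficients of \<open>1 / w\<close> and \<open>1 / w ^ 2\<close> at
  infinity in \<open>partial_fractions_shift\<close>, divided by \<open>s\<close>. The induction on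
  \<open>I\<close> needs no expansion at infinity and covers \<open>s = 0\<close> as well.\<close>

lemma sum_residues_shift:
  fixes a :: "'b \<Rightarrow> 'a::field"
  assumes "finite I" "inj_on a I"
  shows "(\<Sum>i\<in>I. \<Prod>j\<in>I - {i}. (a i + s - a j) / (a i - a j)) = of_nat (card I)"
    and "(\<Sum>i\<in>I. a i * (\<Prod>j\<in>I - {i}. (a i + s - a j) / (a i - a j))) =
           (\<Sum>i\<in>I. a i) + s * of_nat (card I choose 2)"
proof -
  have "(\<Sum>i\<in>I. \<Prod>j\<in>I - {i}. (a i + s - a j) / (a i - a j)) = of_nat (card I) \<and>
     (\<Sum>i\<in>I. a i * (\<Prod>j\<in>I - {i}. (a i + s - a j) / (a i - a j))) =
           (\<Sum>i\<in>I. a i) + s * of_nat (card I choose 2)"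
    using assms
  proof (induction I rule: finite_induct)
    case empty
    then show ?case by (simp add: numeral_2_eq_2)
  next
    case (insert b I)
    let ?p = "\<lambda>i. \<Prod>j\<in>I - {i}. (a i + s - a j) / (a i - a j)"
    let ?R = "\<Sum>i\<in>I. ?p i / (a b - a i)"
    have ne: "a i \<noteq> a b" if "i \<in> I" for i
      using insert.prems insert.hyps that by (auto simp: inj_on_def)
    have IH: "(\<Sum>i\<in>I. ?p i) = of_nat (card I)"
       "(\<Sum>i\<in>I. a i * ?p i) = (\<Sum>i\<in>I. a i) + s * of_nat (card I choose 2)"
      using insert by auto
    have split: "(\<Prod>j\<in>insert b I - {i}. (a i + s - a j) / (a i - a j)) =
        ?p i - s * (?p i / (a b - a i))" if "i \<in> I" for i
    proof -
      have "insert b I - {i} = insert b (I - {i})" using that insert.hyps by auto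
      moreover have "(a i + s - a b) / (a i - a b) = 1 - s / (a b - a i)"
        using ne[OF that] by (simp add: field_simps)
      ultimately have "(\<Prod>j\<in>insert b I - {i}. (a i + s - a j) / (a i - a j)) =
          (1 - s / (a b - a i)) * ?p i"
        using insert.hyps by simp
      then show ?thesis by (simp add: left_diff_distrib)
    qed
    have pb: "(\<Prod>j\<in>I. (a b + s - a j) / (a b - a j)) = 1 + s * ?R"
      by (rule partial_fractions_shift) (use insert ne in auto)
    \<comment> \<open>Writing \<open>a i = a b - (a b - a i)\<close> reduces this weighted sum to
      \<open>?R\<close> and the plain sum of the \<open>?p i\<close>.\<close>
    have "(\<Sum>i\<in>I. a i * (?p i / (a b - a i))) = (\<Sum>i\<in>I. a b * (?p i / (a b - a i)) - ?p i)"
    proof (rule sum.cong[OF refl])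
      fix i assume "i \<in> I"
      then have "a b - a i \<noteq> 0" using ne[of i] by auto
      then show "a i * (?p i / (a b - a i)) = a b * (?p i / (a b - a i)) - ?p i"
        by (simp add: field_simps)
    qed
    then have aR: "(\<Sum>i\<in>I. a i * (?p i / (a b - a i))) = a b * ?R - of_nat (card I)"
      by (simp add: sum_subtractf sum_distrib_left IH)
    have "(\<Sum>i\<in>I. \<Prod>j\<in>insert b I - {i}. (a i + s - a j) / (a i - a j)) = of_nat (card I) - s * ?R"
      by (simp add: split sum_subtractf IH sum_distrib_left)
    moreover have "(\<Sum>i\<in>I. a i * (\<Prod>j\<in>insert b I - {i}. (a i + s - a j) / (a i - a j))) =
       (\<Sum>i\<in>I. a i) + s * of_nat (card I choose 2) - s * (a b * ?R - of_nat (card I))"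
    proof -
      have "(\<Sum>i\<in>I. a i * (\<Prod>j\<in>insert b I - {i}. (a i + s - a j) / (a i - a j))) =
        (\<Sum>i\<in>I. a i * ?p i - s * (a i * (?p i / (a b - a i))))"
        by (rule sum.cong) (simp_all add: split right_diff_distrib mult.left_commute)
      then show ?thesis by (simp only: sum_subtractf IH aR flip: sum_distrib_left)
    qed
    moreover have "of_nat (Suc (card I) choose 2) = (of_nat (card I choose 2) + of_nat (card I) :: 'a)"
      by (simp add: numeral_2_eq_2)
    ultimately show ?case using insert.hyps pb
      by (simp add: algebra_simps)
  qed
  then show "(\<Sum>i\<in>I. \<Prod>j\<in>I - {i}. (a i + s - a j) / (a i - a j)) = of_nat (card I)"
    and "(\<Sum>i\<in>I. a i * (\<Prod>j\<in>I - {i}. (a i + s - a j) / (a i - a j))) =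
           (\<Sum>i\<in>I. a i) + s * of_nat (card I choose 2)" by auto
qed

section \<open>The branching rule for standard Young tableaux\<close>

text \<open>The rows whose last box can be removed. The condition \<open>l i \<noteq> 0\<close>
  excludes empty rows, which truncated subtraction would leave unchanged.\<close>

definition corners :: "(nat \<Rightarrow> nat) \<Rightarrow> nat set" where
  "corners l = {i. l i \<noteq> 0 \<and> l(i := l i - 1) \<in> partitions}"

lemma finite_support_upd:
  "finite {j. (l(i := m)) j \<noteq> (0::nat)} \<longleftrightarrow> finite {j. l j \<noteq> 0}"
proof
  assume "finite {j. (l(i := m)) j \<noteq> 0}"
  then show "finite {j. l j \<noteq> 0}"
    by (rule rev_finite_subset[OF finite.insertI[of _ i]]) auto
next
  assume "finite {j. l j \<noteq> 0}"
  then show "finite {j. (l(i := m)) j \<noteq> 0}"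
    by (rule rev_finite_subset[OF finite.insertI[of _ i]]) auto
qed

lemma corners_iff:
  assumes "l \<in> partitions"
  shows "i \<in> corners l \<longleftrightarrow> l (Suc i) < l i"
proof -
  have anti: "l (Suc j) \<le> l j" for j
    using assms by (simp add: partitions_def antimono_iff_le_Suc)
  have "finite {j. (l(i := l i - 1)) j \<noteq> 0}"
    using assms by (simp only: finite_support_upd) (simp add: partitions_def)
  then have "i \<in> corners l \<longleftrightarrow>
     l i \<noteq> 0 \<and> (\<forall>j. (l(i := l i - 1)) (Suc j) \<le> (l(i := l i - 1)) j)"
    by (simp add: corners_def partitions_def antimono_iff_le_Suc)
  also have "\<dots> \<longleftrightarrow> l (Suc i) < l i"
  proof
    assume *: "l i \<noteq> 0 \<and> (\<forall>j. (l(i := l i - 1)) (Suc j) \<le> (l(i := l i - 1)) j)"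
    then have "(l(i := l i - 1)) (Suc i) \<le> (l(i := l i - 1)) i" by blast
    then have "l (Suc i) \<le> l i - 1" by simp
    with * show "l (Suc i) < l i" by linarith
  next
    assume *: "l (Suc i) < l i"
    have "(l(i := l i - 1)) (Suc j) \<le> (l(i := l i - 1)) j" for j
      using * anti[of j] by (cases "j = i") auto
    with * show "l i \<noteq> 0 \<and> (\<forall>j. (l(i := l i - 1)) (Suc j) \<le> (l(i := l i - 1)) j)" by auto
  qed
  finally show ?thesis .
qed

lemma finite_corners: "l \<in> partitions \<Longrightarrow> finite (corners l)"
  by (rule finite_subset[of _ "{i. l i \<noteq> 0}"]) (auto simp: corners_def partitions_def)

section \<open>Size of a partition when a box is added or removed\<close>

lemma psize_eq_sum:
  assumes "\<And>i. i \<ge> k \<Longrightarrow> l i = 0"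
  shows "psize l = (\<Sum>i<k. l i)"
  unfolding psize_def
proof (rule sum.mono_neutral_left)
  show "{i. l i \<noteq> 0} \<subseteq> {..<k}" using assms by (metis (mono_tags) lessThan_iff mem_Collect_eq not_less subsetI)
qed auto

lemma partitions_bounded:
  assumes "l \<in> partitions"
  obtains k where "\<And>i. i \<ge> k \<Longrightarrow> l i = 0"
proof -
  have "finite {i. l i \<noteq> 0}" using assms by (simp add: partitions_def)
  then obtain k where "\<forall>i\<in>{i. l i \<noteq> 0}. i < k" by (auto simp: finite_nat_set_iff_bounded)
  then show ?thesis by (intro that[of k]) (metis (mono_tags) mem_Collect_eq not_less)
qed

lemma psize_add_box:
  assumes "l \<in> partitions"
  shows "psize (l(i := Suc (l i))) = Suc (psize l)"
proof -
  obtain k where k: "\<And>i. i \<ge> k \<Longrightarrow> l i = 0" using partitions_bounded[OF assms] by blast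
  define K where "K = max k (Suc i)"
  have "psize (l(i := Suc (l i))) = (\<Sum>j<K. (l(i := Suc (l i))) j)"
    by (rule psize_eq_sum) (use k in \<open>auto simp: K_def\<close>)
  also have "\<dots> = (\<Sum>j<K. l j + (if j = i then 1 else 0))"
    by (rule sum.cong) auto
  also have "\<dots> = Suc (\<Sum>j<K. l j)" by (simp add: sum.distrib K_def)
  also have "(\<Sum>j<K. l j) = psize l"
    by (rule psize_eq_sum[symmetric]) (use k in \<open>auto simp: K_def\<close>)
  finally show ?thesis .
qed

lemma psize_remove_corner:
  assumes "i \<in> corners l"
  shows "Suc (psize (l(i := l i - 1))) = psize l"
proof -
  have "l = (l(i := l i - 1))(i := Suc ((l(i := l i - 1)) i))"
    using assms by (auto simp: corners_def)
  then show ?thesis using psize_add_box[of "l(i := l i - 1)" i] assms by (simp add: corners_def)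
qed

section \<open>Standard tableaux and their largest entry\<close>

lemma young_diagram_add_box:
  "young_diagram (l(i := Suc (l i))) = insert (i, l i) (young_diagram l)"
  by (auto simp: young_diagram_def split: if_splits)

lemma finite_standard_young_tableaux:
  assumes "l \<in> partitions"
  shows "finite (standard_young_tableaux l)"
proof (rule finite_subset)
  have "young_diagram l \<subseteq> (SIGMA i:{i. l i \<noteq> 0}. {..<l i})" by (auto simp: young_diagram_def)
  then have "finite (young_diagram l)"
    using assms by (auto simp: partitions_def intro: finite_subset)
  then show "finite (young_diagram l \<rightarrow>\<^sub>E {1..psize l})" by (intro finite_PiE) auto
  show "standard_young_tableaux l \<subseteq> young_diagram l \<rightarrow>\<^sub>E {1..psize l}"
    by (auto simp: standard_young_tableaux_def PiE_def bij_betw_def)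
qed

lemma standard_young_tableauxI:
  assumes "T \<in> extensional (young_diagram l)" "bij_betw T (young_diagram l) {1..psize l}"
    and "\<And>i j j'. (i, j') \<in> young_diagram l \<Longrightarrow> j < j' \<Longrightarrow> T (i, j) < T (i, j')"
    and "\<And>i i' j. (i, j) \<in> young_diagram l \<Longrightarrow> (i', j) \<in> young_diagram l \<Longrightarrow> i < i' \<Longrightarrow>
           T (i, j) < T (i', j)"
  shows "T \<in> standard_young_tableaux l"
  using assms by (auto simp: standard_young_tableaux_def)

text \<open>Writing the largest entry into the new box and deleting it again are inverse bijections.
  Restriction to the smaller diagram resets the value at the deleted box to
  \<open>undefined\<close>, as extensionality demands.\<close>

lemma card_tableaux_largest_entry:
  assumes l: "l \<in> partitions" and l': "l' = l(i := Suc (l i))" "l' \<in> partitions"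
  shows "card {T \<in> standard_young_tableaux l'. T (i, l i) = psize l'} = pdim l"
proof -
  define c where "c = (i, l i)"
  define n where "n = psize l"
  let ?Y = "young_diagram l"
  have n': "psize l' = Suc n" unfolding l' n_def by (rule psize_add_box[OF l])
  have Y': "young_diagram l' = insert c ?Y" unfolding l' c_def by (rule young_diagram_add_box)
  have c: "c \<notin> ?Y" by (simp add: c_def young_diagram_def)
  have anti: "l b \<le> l a" if "a \<le> b" for a b
    using l that by (auto simp: partitions_def antimono_def)
  have "bij_betw (\<lambda>S. S(c := Suc n)) (standard_young_tableaux l)
          {T \<in> standard_young_tableaux l'. T c = Suc n}"
  proof (rule bij_betw_byWitness[where f' = "\<lambda>T. restrict T ?Y"])
    show "\<forall>S\<in>standard_young_tableaux l. restrict (S(c := Suc n)) ?Y = S"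
      using c by (auto simp: standard_young_tableaux_def extensional_def restrict_def fun_eq_iff)
    show "\<forall>T\<in>{T \<in> standard_young_tableaux l'. T c = Suc n}. (restrict T ?Y)(c := Suc n) = T"
      using c by (auto simp: standard_young_tableaux_def extensional_def restrict_def fun_eq_iff Y')
    show "(\<lambda>S. S(c := Suc n)) ` standard_young_tableaux l \<subseteq>
        {T \<in> standard_young_tableaux l'. T c = Suc n}"
    proof safe
      fix S assume S: "S \<in> standard_young_tableaux l"
      then have bij: "bij_betw S ?Y {1..n}" and ext: "S \<in> extensional ?Y"
        and row: "\<And>a j j'. (a, j') \<in> ?Y \<Longrightarrow> j < j' \<Longrightarrow> S (a, j) < S (a, j')"
        and col: "\<And>a a' j. (a, j) \<in> ?Y \<Longrightarrow> (a', j) \<in> ?Y \<Longrightarrow> a < a' \<Longrightarrow> S (a, j) < S (a', j)"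
        by (auto simp: standard_young_tableaux_def n_def)
      have le: "S x < Suc n" if "x \<in> ?Y" for x using bij_betwE[OF bij] that by fastforce
      show "S(c := Suc n) \<in> standard_young_tableaux l'"
      proof (rule standard_young_tableauxI)
        show "S(c := Suc n) \<in> extensional (young_diagram l')"
          using ext by (auto simp: extensional_def Y')
        have "bij_betw (S(c := Suc n)) ?Y {1..n}"
          using bij by (rule bij_betw_cong[THEN iffD1, rotated]) (use c in auto)
        then have "bij_betw (S(c := Suc n)) (?Y \<union> {c}) ({1..n} \<union> {(S(c := Suc n)) c})"
          using c by (intro notIn_Un_bij_betw) auto
        then show "bij_betw (S(c := Suc n)) (young_diagram l') {1..psize l'}"
          by (simp add: Y' n' atLeastAtMostSuc_conv)
      next
        fix a j j' assume *: "(a, j') \<in> young_diagram l'" "j < j'"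
        then have "(a, j') \<in> insert c ?Y" by (simp add: Y')
        with *(2) have "(a, j) \<in> ?Y" by (auto simp: c_def young_diagram_def)
        then show "(S(c := Suc n)) (a, j) < (S(c := Suc n)) (a, j')"
          using * c row le by (auto simp: Y')
      next
        fix a a' j assume *: "(a, j) \<in> young_diagram l'" "(a', j) \<in> young_diagram l'" "a < a'"
        \<comment> \<open>No box lies below \<open>c\<close> in its column: it would need a row
          after \<open>i\<close> that is longer than \<open>l i\<close>.\<close>
        from *(2) have "(a', j) \<in> insert c ?Y" by (simp add: Y')
        with *(3) have "(a, j) \<noteq> c"
          using anti[of a a'] by (auto simp: c_def young_diagram_def)
        then show "(S(c := Suc n)) (a, j) < (S(c := Suc n)) (a', j)"
          using * col le by (auto simp: Y')
      qed
    qed auto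
    show "(\<lambda>T. restrict T ?Y) ` {T \<in> standard_young_tableaux l'. T c = Suc n} \<subseteq>
       standard_young_tableaux l"
    proof safe
      fix T assume T: "T \<in> standard_young_tableaux l'" and Tc: "T c = Suc n"
      have bij: "bij_betw T (insert c ?Y) {1..Suc n}"
        using T by (simp add: standard_young_tableaux_def n' Y')
      show "restrict T ?Y \<in> standard_young_tableaux l"
      proof (rule standard_young_tableauxI)
        have "bij_betw T (insert c ?Y - {c}) ({1..Suc n} - {T c})"
          using bij Tc by (intro bij_betw_DiffI) (auto simp: bij_betw_def)
        moreover have "insert c ?Y - {c} = ?Y" using c by auto
        moreover have "{1..Suc n} - {T c} = {1..n}" using Tc by auto
        ultimately have "bij_betw T ?Y {1..n}" by simp
        then show "bij_betw (restrict T ?Y) ?Y {1..psize l}"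
          by (simp add: n_def bij_betw_def inj_on_restrict_eq)
      next
        fix a j j' assume *: "(a, j') \<in> ?Y" "j < j'"
        then have "(a, j) \<in> ?Y" by (auto simp: young_diagram_def)
        moreover have "T (a, j) < T (a, j')"
          using T * by (auto simp: standard_young_tableaux_def Y')
        ultimately show "restrict T ?Y (a, j) < restrict T ?Y (a, j')" using * by simp
      next
        fix a a' j assume *: "(a, j) \<in> ?Y" "(a', j) \<in> ?Y" "a < a'"
        moreover have "T (a, j) < T (a', j)"
          using T * by (auto simp: standard_young_tableaux_def Y')
        ultimately show "restrict T ?Y (a, j) < restrict T ?Y (a', j)" by simp
      qed auto
    qed
  qed
  from bij_betw_same_card[OF this] show ?thesis by (simp add: pdim_def c_def n')
qed

text \<open>Tableaux are sorted by the row of their largest entry \<open>psize l\<close>. Entries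
  increase along rows and columns, so this entry ends its row and its column and its row is a
  corner. Injectivity of the filling makes the classes disjoint.\<close>

lemma pdim_branching:
  assumes l: "l \<in> partitions" "psize l \<noteq> 0"
  shows "pdim l = (\<Sum>i\<in>corners l. pdim (l(i := l i - 1)))"
proof -
  define B where "B i = {T \<in> standard_young_tableaux l. T (i, l i - 1) = psize l}" for i
  have corner_cell: "(i, l i - 1) \<in> young_diagram l" if "i \<in> corners l" for i
    using that by (auto simp: corners_def young_diagram_def)
  have "standard_young_tableaux l = (\<Union>i\<in>corners l. B i)"
  proof (intro equalityI subsetI)
    fix T assume T: "T \<in> standard_young_tableaux l"
    then have bij: "bij_betw T (young_diagram l) {1..psize l}"
      by (simp add: standard_young_tableaux_def)
    moreover have "psize l \<in> {1..psize l}" using l by auto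
    ultimately obtain i j where ij: "(i, j) \<in> young_diagram l" "T (i, j) = psize l"
      unfolding bij_betw_def by (metis imageE surj_pair)
    have le: "T c \<le> psize l" if "c \<in> young_diagram l" for c
      using bij that by (auto simp: bij_betw_def)
    have "(i, Suc j) \<notin> young_diagram l"
    proof
      assume "(i, Suc j) \<in> young_diagram l"
      then have "T (i, j) < T (i, Suc j)" "T (i, Suc j) \<le> psize l"
        using T le by (auto simp: standard_young_tableaux_def)
      then show False using ij by simp
    qed
    then have j: "l i = Suc j" using ij by (auto simp: young_diagram_def)
    have "(Suc i, j) \<notin> young_diagram l"
    proof
      assume "(Suc i, j) \<in> young_diagram l"
      moreover from this have "T (i, j) < T (Suc i, j)"
        using T ij(1) unfolding standard_young_tableaux_def by blast
      ultimately have "T (i, j) < T (Suc i, j)" "T (Suc i, j) \<le> psize l"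
        using le by auto
      then show False using ij by simp
    qed
    then have "i \<in> corners l" using j by (simp add: young_diagram_def corners_iff[OF l(1)])
    moreover have "T \<in> B i" using T ij j by (simp add: B_def)
    ultimately show "T \<in> (\<Union>i\<in>corners l. B i)" by blast
  qed (auto simp: B_def)
  moreover have "card (\<Union>i\<in>corners l. B i) = (\<Sum>i\<in>corners l. card (B i))"
  proof (rule card_UN_disjoint)
    show "finite (corners l)" by (rule finite_corners[OF l(1)])
    show "\<forall>i\<in>corners l. finite (B i)"
      using finite_standard_young_tableaux[OF l(1)] by (auto simp: B_def)
    show "\<forall>i\<in>corners l. \<forall>j\<in>corners l. i \<noteq> j \<longrightarrow> B i \<inter> B j = {}"
    proof safe
      fix i j T assume *: "i \<in> corners l" "j \<in> corners l" "T \<in> B i" "T \<in> B j" and "i \<noteq> j"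
      then have "inj_on T (young_diagram l)"
        by (simp add: B_def standard_young_tableaux_def bij_betw_def)
      from inj_onD[OF this, of "(i, l i - 1)" "(j, l j - 1)"] show "T \<in> {}"
        using * \<open>i \<noteq> j\<close> corner_cell by (simp add: B_def)
    qed
  qed
  moreover have "card (B i) = pdim (l(i := l i - 1))" if "i \<in> corners l" for i
    using card_tableaux_largest_entry[of "l(i := l i - 1)" l i] that l
    by (simp add: corners_def B_def)
  ultimately show ?thesis by (simp add: pdim_def)
qed

lemma partition_psize_0:
  assumes "l \<in> partitions" "psize l = 0"
  shows "l = (\<lambda>_. 0)"
  using assms by (auto simp: psize_def partitions_def)

text \<open>On the empty diagram extensionality leaves exactly one filling, the one that is
  \<open>undefined\<close> everywhere.\<close>

lemma pdim_empty: "pdim (\<lambda>_. 0) = 1"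
proof -
  have "standard_young_tableaux (\<lambda>_. 0) = {\<lambda>_. undefined}"
    by (auto simp: standard_young_tableaux_def young_diagram_def psize_def bij_betw_def)
  then show ?thesis by (simp add: pdim_def)
qed

section \<open>Frobenius' formula for the number of standard tableaux\<close>

text \<open>The sign convention makes the value positive for strictly decreasing real sequences;
  beta numbers are listed in that order.\<close>

definition vandermonde :: "nat \<Rightarrow> (nat \<Rightarrow> 'a) \<Rightarrow> 'a::comm_ring_1" where
  "vandermonde k a = (\<Prod>j<k. \<Prod>i<j. a i - a j)"

text \<open>Replacing \<open>a m\<close> by \<open>y\<close> affects only the factors that involve
  index \<open>m\<close>, and the signs of these agree on both sides. The cross-multiplied form
  makes sense in every commutative ring.\<close>

lemma vandermonde_upd:
  assumes "m < k"
  shows "vandermonde k (a(m := y)) * (\<Prod>j\<in>{..<k} - {m}. a m - a j) =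
           vandermonde k a * (\<Prod>j\<in>{..<k} - {m}. y - a j)"
  using assms
proof (induction k)
  case (Suc k)
  show ?case
  proof (cases "m = k")
    case True
    have V: "vandermonde k (a(k := y)) = vandermonde k a"
      unfolding vandermonde_def by (intro prod.cong) auto
    have lt: "{..<Suc k} - {k} = {..<k}" by auto
    \<comment> \<open>Here \<open>m\<close> is the last index, so all new factors change; the two
      sides agree factor by factor because two signs are flipped in each.\<close>
    have "(\<Prod>i<k. (a(k := y)) i - y) * (\<Prod>i<k. a k - a i) = (\<Prod>i<k. a i - a k) * (\<Prod>i<k. y - a i)"
      unfolding prod.distrib[symmetric] by (rule prod.cong) (auto simp: algebra_simps)
    then show ?thesis unfolding True lt
      using V by (simp add: vandermonde_def mult.assoc)
  next
    case False
    with Suc.prems have m: "m < k" by simp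
    have split: "{..<Suc k} - {m} = insert k ({..<k} - {m})" using m by auto
    have pr: "(\<Prod>i<k. b i - a k) = (b m - a k) * (\<Prod>i\<in>{..<k} - {m}. b i - a k)" for b
      using m by (intro prod.remove) auto
    have "(\<Prod>i\<in>{..<k} - {m}. (a(m := y)) i - a k) = (\<Prod>i\<in>{..<k} - {m}. a i - a k)"
      by (rule prod.cong) auto
    then have V1: "vandermonde (Suc k) (a(m := y)) =
        vandermonde k (a(m := y)) * ((y - a k) * (\<Prod>i\<in>{..<k} - {m}. a i - a k))"
      using m pr[of "a(m := y)"] by (simp add: vandermonde_def)
    have V2: "vandermonde (Suc k) a =
        vandermonde k a * ((a m - a k) * (\<Prod>i\<in>{..<k} - {m}. a i - a k))"
      using pr[of a] by (simp add: vandermonde_def)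
    have P: "(\<Prod>j\<in>{..<Suc k} - {m}. c - a j) = (c - a k) * (\<Prod>j\<in>{..<k} - {m}. c - a j)" for c
      by (simp add: split)
    have "A * (u * R) * (v * P) = B * (v * R) * (u * Q)" if "A * P = B * Q"
      for A B P Q R u v :: 'a
    proof -
      have "A * (u * R) * (v * P) = (A * P) * (u * v * R)" by (simp only: mult_ac)
      also have "\<dots> = B * (v * R) * (u * Q)" by (simp only: that mult_ac)
      finally show ?thesis .
    qed
    from this[OF Suc.IH[OF m]] show ?thesis unfolding V1 V2 P .
  qed
qed simp

lemma vandermonde_upd_quotient:
  fixes a :: "nat \<Rightarrow> 'a::field"
  assumes "m < k" "inj_on a {..<k}"
  shows "vandermonde k (a(m := y)) =
           vandermonde k a * (\<Prod>j\<in>{..<k} - {m}. (y - a j) / (a m - a j))"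
proof -
  have "(\<Prod>j\<in>{..<k} - {m}. a m - a j) \<noteq> 0"
    using assms by (auto simp: inj_on_def)
  then show ?thesis using vandermonde_upd[OF assms(1), of a y]
    by (simp add: prod_dividef field_simps)
qed

text \<open>For a partition with at most \<open>k\<close> parts, \<open>beta k l\<close> lists its beta numbers in decreasing order.\<close>

definition beta :: "nat \<Rightarrow> (nat \<Rightarrow> nat) \<Rightarrow> nat \<Rightarrow> nat" where
  "beta k l i = l i + (k - Suc i)"

text \<open>Frobenius' expression for \<open>dim l / |l|!\<close>. Here \<open>k\<close> bounds the
  number of parts; trailing empty rows are allowed.\<close>

definition frobenius :: "nat \<Rightarrow> (nat \<Rightarrow> nat) \<Rightarrow> 'a::field_char_0" where
  "frobenius k l = vandermonde k (\<lambda>i. of_nat (beta k l i)) / (\<Prod>i<k. fact (beta k l i))"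

section \<open>Effect of changing one row on Frobenius' expression\<close>

lemma inj_on_beta:
  assumes "antimono l"
  shows "inj_on (beta k l) {..<k}"
proof (rule linorder_inj_onI)
  fix i j assume *: "i < j" "i \<in> {..<k}" "j \<in> {..<k}"
  then have "l j \<le> l i" using antimonoD[OF assms, of i j] by simp
  with * show "beta k l i \<noteq> beta k l j" by (auto simp: beta_def)
qed auto

lemma inj_on_of_nat_beta:
  "antimono l \<Longrightarrow> inj_on (\<lambda>i. of_nat (beta k l i) :: 'a::ring_char_0) {..<k}"
  using inj_on_beta[of l k] by (auto simp: inj_on_def)

text \<open>A change of row \<open>m\<close> changes one beta number, hence one factorial and the
  Vandermonde factors at \<open>m\<close>. Keeping the factorials on both sides lets the same
  identity serve for adding and for removing a box.\<close>

lemma frobenius_upd: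
  assumes "antimono l" "m < k"
  shows "frobenius k (l(m := y)) * fact (beta k (l(m := y)) m) =
    (frobenius k l * fact (beta k l m) * (\<Prod>j\<in>{..<k} - {m}.
       (of_nat (beta k (l(m := y)) m) - of_nat (beta k l j)) /
       (of_nat (beta k l m) - of_nat (beta k l j))) :: 'a::field_char_0)"
proof -
  let ?b = "\<lambda>i. of_nat (beta k l i) :: 'a"
  let ?l = "l(m := y)"
  define P :: 'a where "P = (\<Prod>i\<in>{..<k} - {m}. fact (beta k l i))"
  have P: "P \<noteq> 0" by (simp add: P_def)
  have "(\<lambda>i. of_nat (beta k ?l i) :: 'a) = ?b(m := of_nat (beta k ?l m))"
    by (auto simp: beta_def)
  then have V: "vandermonde k (\<lambda>i. of_nat (beta k ?l i) :: 'a) = vandermonde k ?b *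
      (\<Prod>j\<in>{..<k} - {m}. (of_nat (beta k ?l m) - ?b j) / (?b m - ?b j))"
    using vandermonde_upd_quotient[OF assms(2) inj_on_of_nat_beta[OF assms(1)]] by simp
  have "(\<Prod>i<k. fact (beta k ?l i) :: 'a) = fact (beta k ?l m) * (\<Prod>i\<in>{..<k} - {m}. fact (beta k ?l i))"
    using assms by (intro prod.remove) auto
  also have "(\<Prod>i\<in>{..<k} - {m}. fact (beta k ?l i)) = P"
    unfolding P_def by (rule prod.cong) (auto simp: beta_def)
  finally have 1: "(\<Prod>i<k. fact (beta k ?l i) :: 'a) = fact (beta k ?l m) * P" .
  have 2: "(\<Prod>i<k. fact (beta k l i) :: 'a) = fact (beta k l m) * P"
    unfolding P_def using assms by (intro prod.remove) auto
  show ?thesis unfolding frobenius_def V 1 2 using P by simp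
qed

text \<open>The beta number of row \<open>m\<close> grows by one. The product is the one in
  \<open>partial_fractions_shift\<close> for \<open>s = 1\<close>, and \<open>1 / (b m + 1)\<close>
  is the quotient of the factorials.\<close>

lemma frobenius_add_box:
  fixes k l m
  defines "b \<equiv> \<lambda>i. of_nat (beta k l i) :: 'a::field_char_0"
  assumes "antimono l" "m < k"
  shows "frobenius k (l(m := Suc (l m))) =
    frobenius k l * ((\<Prod>j\<in>{..<k} - {m}. (b m + 1 - b j) / (b m - b j)) / (b m + 1))"
proof -
  define l' where "l' = l(m := Suc (l m))"
  let ?P = "\<Prod>j\<in>{..<k} - {m}. (b m + 1 - b j) / (b m - b j)"
  have *: "beta k l' m = Suc (beta k l m)" by (simp add: beta_def l'_def)
  then have bm: "of_nat (beta k l' m) = b m + 1" by (simp add: b_def)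
  have nz: "b m + 1 \<noteq> 0" unfolding b_def by (metis add.commute of_nat_Suc of_nat_neq_0)
  have "frobenius k l' * fact (beta k l' m) = frobenius k l * fact (beta k l m) * ?P"
    using frobenius_upd[OF assms(2,3), of "Suc (l m)", where ?'a = 'a] 
    unfolding l'_def[symmetric] bm by (simp add: b_def)
  also have "fact (beta k l' m) = (b m + 1) * fact (beta k l m)"
    by (simp add: * b_def add.commute)
  finally have "frobenius k l' * (b m + 1) = frobenius k l * ?P" by simp
  then show ?thesis using nz by (simp add: nonzero_eq_divide_eq flip: l'_def)
qed

text \<open>The counterpart with \<open>s = -1\<close>; now the quotient of the factorials is the
  factor \<open>b m\<close>.\<close>

lemma frobenius_remove_box:
  fixes k l m
  defines "b \<equiv> \<lambda>i. of_nat (beta k l i) :: 'a::field_char_0"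
  assumes "antimono l" "m < k" "l m \<noteq> 0"
  shows "frobenius k (l(m := l m - 1)) =
    frobenius k l * (b m * (\<Prod>j\<in>{..<k} - {m}. (b m - 1 - b j) / (b m - b j)))"
proof -
  define l' where "l' = l(m := l m - 1)"
  let ?P = "\<Prod>j\<in>{..<k} - {m}. (b m - 1 - b j) / (b m - b j)"
  have *: "beta k l m = Suc (beta k l' m)" using assms(4) by (simp add: beta_def l'_def)
  then have bm: "of_nat (beta k l' m) = b m - 1" by (simp add: b_def)
  have "frobenius k l' * fact (beta k l' m) = frobenius k l * fact (beta k l m) * ?P"
    using frobenius_upd[OF assms(2,3), of "l m - 1", where ?'a = 'a] 
    unfolding l'_def[symmetric] bm by (simp add: b_def)
  also have "fact (beta k l m) = b m * fact (beta k l' m)"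
    by (simp add: * b_def)
  finally have "frobenius k l' = frobenius k l * (b m * ?P)" by simp
  then show ?thesis unfolding l'_def .
qed

section \<open>Box removal and Frobenius' formula\<close>

lemma sum_staircase: "(\<Sum>i<k. k - Suc i) = k choose 2"
  by (subst sum.nat_diff_reindex) (simp add: Sum_Ico_nat choose_two flip: atLeast0LessThan)

text \<open>This is the recursion that branching imposes on \<open>dim l / |l|!\<close>. Rows that
  are not corners contribute zero, so the sum runs over all \<open>i < k\<close>, and the second
  identity of \<open>sum_residues_shift\<close> with \<open>s = -1\<close> evaluates it. The beta
  numbers add up to \<open>psize l + (k choose 2)\<close>, and the binomial coefficient
  cancels.\<close>

lemma frobenius_down:
  assumes l: "l \<in> partitions" "\<And>i. i \<ge> k \<Longrightarrow> l i = 0"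
  shows "(\<Sum>i\<in>corners l. frobenius k (l(i := l i - 1))) =
           (of_nat (psize l) * frobenius k l :: 'a::field_char_0)"
proof -
  define b where "b = (\<lambda>i. of_nat (beta k l i) :: 'a)"
  define p where "p i = b i * (\<Prod>j\<in>{..<k} - {i}. (b i + (-1) - b j) / (b i - b j))" for i
  have anti: "antimono l" using l by (simp add: partitions_def)
  have lt: "i < k" if "l i \<noteq> 0" for i using l(2)[of i] that by (cases "i < k") auto
  have "(\<Sum>i\<in>corners l. frobenius k (l(i := l i - 1))) = (\<Sum>i\<in>corners l. frobenius k l * p i)"
  proof (rule sum.cong[OF refl])
    fix i assume "i \<in> corners l"
    then have "l i \<noteq> 0" by (simp add: corners_def)
    with lt show "frobenius k (l(i := l i - 1)) = frobenius k l * p i"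
      using frobenius_remove_box[OF anti, of i k, where ?'a = 'a] by (simp add: p_def b_def)
  qed
  also have "\<dots> = (\<Sum>i<k. frobenius k l * p i)"
  proof (rule sum.mono_neutral_left)
    show "corners l \<subseteq> {..<k}" using lt by (auto simp: corners_def)
    show "\<forall>i\<in>{..<k} - corners l. frobenius k l * p i = 0"
    proof
      fix i assume i: "i \<in> {..<k} - corners l"
      then have le: "l i \<le> l (Suc i)" by (simp add: corners_iff[OF l(1)])
      have "p i = 0"
      \<comment> \<open>If the next row is among the first \<open>k\<close>, it is equally long, the
        two beta numbers are consecutive and one factor of the product vanishes. In the last row
        \<open>l i = 0\<close>, so the factor \<open>b i\<close> itself is zero.\<close>
      proof (cases "Suc i < k")
        case True
        have "l (Suc i) = l i" using le antimonoD[OF anti, of i "Suc i"] by simp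
        then have "beta k l i = Suc (beta k l (Suc i))" using True by (simp add: beta_def)
        then have "b i + (-1) - b (Suc i) = 0" by (simp add: b_def)
        then have "(\<Prod>j\<in>{..<k} - {i}. (b i + (-1) - b j) / (b i - b j)) = 0"
          using True by (intro prod_zero bexI[of _ "Suc i"]) auto
        then show ?thesis by (simp add: p_def)
      next
        case False
        then show ?thesis using i le l(2)[of "Suc i"] by (simp add: p_def b_def beta_def)
      qed
      then show "frobenius k l * p i = 0" by simp
    qed
  qed simp
  also have "\<dots> = frobenius k l * ((\<Sum>i<k. b i) - of_nat (k choose 2))"
    using sum_residues_shift(2)[of "{..<k}" b "-1"] inj_on_of_nat_beta[OF anti, of k, where ?'a = 'a]
    by (simp add: p_def b_def flip: sum_distrib_left)
  also have "(\<Sum>i<k. b i) = of_nat (\<Sum>i<k. l i + (k - Suc i))"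
    by (simp only: b_def beta_def of_nat_sum)
  also have "(\<Sum>i<k. l i + (k - Suc i)) = psize l + (k choose 2)"
    using psize_eq_sum[of k l] l(2) by (simp only: sum.distrib sum_staircase)
  also have "frobenius k l * (of_nat (psize l + (k choose 2)) - of_nat (k choose 2)) =
      of_nat (psize l) * frobenius k l" by simp
  finally show ?thesis .
qed

text \<open>The beta numbers are \<open>k - 1, ..., 0\<close>; numerator and denominator are both
  the product of the factorials \<open>fact j\<close> for \<open>j < k\<close>.\<close>

lemma frobenius_empty: "frobenius k (\<lambda>_. 0) = 1"
proof -
  have "vandermonde k (\<lambda>i. of_nat (beta k (\<lambda>_. 0) i)) = (\<Prod>j<k. fact j :: 'a::field_char_0)"
    unfolding vandermonde_def
  proof (rule prod.cong[OF refl])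
    fix j assume j: "j \<in> {..<k}"
    have "(\<Prod>i<j. of_nat (beta k (\<lambda>_. 0) i) - of_nat (beta k (\<lambda>_. 0) j)) = (\<Prod>i<j. of_nat (j - i) :: 'a)"
    proof (rule prod.cong[OF refl])
      fix i assume "i \<in> {..<j}"
      then have "beta k (\<lambda>_. 0) i = beta k (\<lambda>_. 0) j + (j - i)" using j by (simp add: beta_def)
      then show "of_nat (beta k (\<lambda>_. 0) i) - of_nat (beta k (\<lambda>_. 0) j) = (of_nat (j - i) :: 'a)" by simp
    qed
    then show "(\<Prod>i<j. of_nat (beta k (\<lambda>_. 0) i) - of_nat (beta k (\<lambda>_. 0) j)) = (fact j :: 'a)"
      by (simp add: fact_prod_rev atLeast0LessThan)
  qed
  moreover have "(\<Prod>i<k. fact (beta k (\<lambda>_. 0) i)) = (\<Prod>j<k. fact j :: 'a)"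
    unfolding beta_def using prod.nat_diff_reindex[of "fact :: nat \<Rightarrow> 'a" k] by simp
  ultimately show ?thesis by (simp add: frobenius_def)
qed

text \<open>By induction on the size, since \<open>pdim_branching\<close> and
  \<open>frobenius_down\<close> give both sides the same recursion. The bound \<open>k\<close> stays
  fixed, as removing a box creates no new rows.\<close>

lemma pdim_eq_frobenius:
  assumes "l \<in> partitions" "\<And>i. i \<ge> k \<Longrightarrow> l i = 0"
  shows "(of_nat (pdim l) :: 'a::field_char_0) = fact (psize l) * frobenius k l"
  using assms
proof (induction "psize l" arbitrary: l)
  case 0
  then have "l = (\<lambda>_. 0)" using partition_psize_0[of l] by simp
  then show ?case by (simp add: pdim_empty frobenius_empty psize_def)
next
  case (Suc n)
  have "(of_nat (pdim l) :: 'a) = (\<Sum>i\<in>corners l. of_nat (pdim (l(i := l i - 1))))"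
    using pdim_branching[of l] Suc by simp
  also have "\<dots> = (\<Sum>i\<in>corners l. fact n * frobenius k (l(i := l i - 1)))"
  proof (rule sum.cong[OF refl])
    fix i assume i: "i \<in> corners l"
    then have "n = psize (l(i := l i - 1))" using psize_remove_corner[OF i] Suc(2) by simp
    with Suc(1)[OF this] i Suc(4) show "(of_nat (pdim (l(i := l i - 1))) :: 'a) =
        fact n * frobenius k (l(i := l i - 1))"
      by (auto simp: corners_def)
  qed
  also have "\<dots> = fact n * (of_nat (psize l) * frobenius k l)"
    unfolding sum_distrib_left[symmetric] using frobenius_down[of l k, where ?'a = 'a] Suc(3,4) by metis
  finally show ?case by (simp add: algebra_simps flip: Suc(2))
qed

section \<open>The transition measure and the recursion over the size\<close>

text \<open>For partitions of \<open>n\<close>, the squares multiplied by \<open>n!\<close> form the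
  Plancherel measure.\<close>

definition pweight :: "(nat \<Rightarrow> nat) \<Rightarrow> 'a::field_char_0" where
  "pweight l = of_nat (pdim l) / fact (psize l)"

lemma pweight_eq_frobenius:
  "l \<in> partitions \<Longrightarrow> (\<And>i. i \<ge> k \<Longrightarrow> l i = 0) \<Longrightarrow> pweight l = frobenius k l"
  using pdim_eq_frobenius[of l k, where ?'a = 'a] by (simp add: pweight_def)

lemma pweight_branching:
  assumes "l \<in> partitions" "psize l = Suc n"
  shows "(\<Sum>i\<in>corners l. pweight (l(i := l i - 1))) = (of_nat (Suc n) * pweight l :: 'a::field_char_0)"
proof -
  have "(\<Sum>i\<in>corners l. pweight (l(i := l i - 1))) =
      (\<Sum>i\<in>corners l. of_nat (pdim (l(i := l i - 1))) / fact n :: 'a)"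
  proof (rule sum.cong[OF refl])
    fix i assume "i \<in> corners l"
    then have "psize (l(i := l i - 1)) = n" using psize_remove_corner[of i l] assms by simp
    then show "pweight (l(i := l i - 1)) = (of_nat (pdim (l(i := l i - 1))) / fact n :: 'a)"
      by (simp only: pweight_def)
  qed
  also have "\<dots> = of_nat (pdim l) / fact n"
    using pdim_branching[of l] assms by (simp add: sum_divide_distrib)
  also have "\<dots> = of_nat (Suc n) * pweight l"
    using assms by (simp add: pweight_def field_simps del: of_nat_Suc)
  finally show ?thesis .
qed

section \<open>Adding boxes\<close>

definition addable :: "(nat \<Rightarrow> nat) \<Rightarrow> nat set" where
  "addable l = {i. l(i := Suc (l i)) \<in> partitions}"

text \<open>A box in a row after \<open>k\<close> would lie below the empty row \<open>k\<close>.
  Hence \<open>Suc k\<close> rows suffice to describe all additions.\<close>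

lemma addable_bound:
  assumes "i \<in> addable l" "\<And>i. i \<ge> k \<Longrightarrow> l i = 0"
  shows "i \<le> k"
proof (rule ccontr)
  assume "\<not> i \<le> k"
  moreover have "antimono (l(i := Suc (l i)))" using assms(1) by (simp add: addable_def partitions_def)
  from antimonoD[OF this, of k i] have "Suc (l i) \<le> (l(i := Suc (l i))) k"
    using \<open>\<not> i \<le> k\<close> by simp
  ultimately show False using assms(2)[of k] by simp
qed

text \<open>Adding a box in row \<open>i\<close> can only violate the comparison with the row
  directly above.\<close>

lemma not_addable:
  assumes "l \<in> partitions" "i \<notin> addable l"
  obtains j where "i = Suc j" "l j = l i"
proof -
  have anti: "l (Suc j) \<le> l j" for j
    using assms by (simp add: partitions_def antimono_iff_le_Suc)
  have "finite {j. (l(i := Suc (l i))) j \<noteq> 0}"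
    using assms by (simp only: finite_support_upd) (simp add: partitions_def)
  then obtain j where j: "\<not> (l(i := Suc (l i))) (Suc j) \<le> (l(i := Suc (l i))) j"
    using assms(2) by (auto simp: addable_def partitions_def antimono_iff_le_Suc)
  have "i = Suc j" "l j = l i"
    using j anti[of j] by (auto split: if_splits)
  then show ?thesis by (rule that)
qed

text \<open>Turns a sum over addable rows into one over all \<open>i < Suc k\<close>, ready for the
  partial fraction identities. A row that is not addable has the length of the row above, so their
  beta numbers are consecutive and its product contains the factor zero. The test function
  \<open>g\<close> allows both the total mass and the Cauchy transform to be computed.\<close>

lemma sum_addable:
  fixes g :: "nat \<Rightarrow> 'a::field_char_0"
  defines "b \<equiv> \<lambda>k l i. of_nat (beta (Suc k) l i) :: 'a"
  assumes l: "l \<in> partitions" "\<And>i. i \<ge> k \<Longrightarrow> l i = 0"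
  shows "(\<Sum>i\<in>addable l. pweight (l(i := Suc (l i))) * g i) =
    pweight l * (\<Sum>i<Suc k. (\<Prod>j\<in>{..<Suc k} - {i}. (b k l i + 1 - b k l j) / (b k l i - b k l j)) /
      (b k l i + 1) * g i)"
proof -
  let ?q = "\<lambda>i. (\<Prod>j\<in>{..<Suc k} - {i}. (b k l i + 1 - b k l j) / (b k l i - b k l j)) / (b k l i + 1)"
  have anti: "antimono l" using l by (simp add: partitions_def)
  have pw: "pweight l = (frobenius (Suc k) l :: 'a)"
    by (rule pweight_eq_frobenius) (use l in auto)
  have "(\<Sum>i\<in>addable l. pweight (l(i := Suc (l i))) * g i) = (\<Sum>i\<in>addable l. pweight l * (?q i * g i))"
  proof (rule sum.cong[OF refl])
    fix i assume i: "i \<in> addable l"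
    then have "i < Suc k" using addable_bound[OF i, of k] l(2) by simp
    have "pweight (l(i := Suc (l i))) = (frobenius (Suc k) (l(i := Suc (l i))) :: 'a)"
      by (rule pweight_eq_frobenius) (use l i \<open>i < Suc k\<close> in \<open>auto simp: addable_def\<close>)
    also have "\<dots> = pweight l * ?q i"
      unfolding pw b_def by (rule frobenius_add_box[OF anti \<open>i < Suc k\<close>])
    finally show "pweight (l(i := Suc (l i))) * g i = pweight l * (?q i * g i)" by simp
  qed
  also have "\<dots> = (\<Sum>i<Suc k. pweight l * (?q i * g i))"
  proof (rule sum.mono_neutral_left)
    show "addable l \<subseteq> {..<Suc k}"
      using addable_bound[of _ l k] l(2) by (auto simp: less_Suc_eq_le)
    show "\<forall>i\<in>{..<Suc k} - addable l. pweight l * (?q i * g i) = 0"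
    proof
      fix i assume i: "i \<in> {..<Suc k} - addable l"
      then obtain j where j: "i = Suc j" "l j = l i" using not_addable[OF l(1), of i] by blast
      have "k - j = Suc (k - Suc j)" using i j(1) by (simp add: Suc_diff_Suc)
      then have "beta (Suc k) l j = Suc (beta (Suc k) l i)"
        using j by (simp only: beta_def diff_Suc_Suc add_Suc_right)
      then have "b k l i + 1 - b k l j = 0" by (simp add: b_def)
      then have "(\<Prod>j\<in>{..<Suc k} - {i}. (b k l i + 1 - b k l j) / (b k l i - b k l j)) = 0"
        using i j by (intro prod_zero bexI[of _ j]) auto
      then show "pweight l * (?q i * g i) = 0" by simp
    qed
  qed simp
  finally show ?thesis by (simp only: sum_distrib_left)
qed

text \<open>The function \<open>F\<^sub>l(x)\<close>. The factors of the boxes in one row,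
  \<open>1 - 1 / (x - c)\<close> with content \<open>c\<close>, telescope to the row factor used
  here.\<close>

definition content_ratio :: "(nat \<Rightarrow> nat) \<Rightarrow> 'a::field_char_0 \<Rightarrow> 'a" where
  "content_ratio l x = Prod_any (\<lambda>i. (x + of_nat i - of_nat (l i)) / (x + of_nat i))"

text \<open>Being no integer keeps all denominators nonzero and is preserved by unit shifts of
  \<open>x\<close>.\<close>

lemma not_Ints_shift:
  assumes "(x :: 'a::ring_1) \<notin> \<int>"
  shows "x + of_nat i \<noteq> 0" "x + of_nat i - of_nat j \<noteq> 0" "x + 1 \<notin> \<int>" "x - 1 \<notin> \<int>"
proof -
  show "x + of_nat i \<noteq> 0" using assms by (metis Ints_minus Ints_of_nat add_eq_0_iff2)
  show "x + of_nat i - of_nat j \<noteq> 0"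
    using assms by (metis Ints_diff Ints_of_nat add_diff_cancel_right' right_minus_eq)
  show "x + 1 \<notin> \<int>" using assms by (metis Ints_1 Ints_diff add_diff_cancel_right')
  show "x - 1 \<notin> \<int>" using assms by (metis Ints_1 Ints_add diff_add_cancel)
qed

text \<open>For \<open>x \<notin> \<int>\<close> every empty row contributes the factor 1; at
  \<open>x = - of_nat i\<close> the quotient \<open>0 / 0 = 0\<close> would spoil this.\<close>

lemma content_ratio_eq_prod:
  assumes "\<And>i. i \<ge> k \<Longrightarrow> l i = 0" "x \<notin> \<int>"
  shows "content_ratio l x = (\<Prod>i<k. (x + of_nat i - of_nat (l i)) / (x + of_nat i))"
  unfolding content_ratio_def
proof (rule Prod_any.expand_superset)
  show "{i. (x + of_nat i - of_nat (l i)) / (x + of_nat i) \<noteq> 1} \<subseteq> {..<k}"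
  proof
    fix i assume i: "i \<in> {i. (x + of_nat i - of_nat (l i)) / (x + of_nat i) \<noteq> 1}"
    have "l i \<noteq> 0" using i not_Ints_shift(1)[OF assms(2), of i] by (intro notI) simp
    then show "i \<in> {..<k}" using assms(1)[of i] by (cases "i < k") auto
  qed
qed simp

text \<open>Only the factor of row \<open>i\<close> changes; the content of the new box is
  \<open>l i - i\<close>, taken in the field.\<close>

lemma content_ratio_add_box:
  assumes "l \<in> partitions" "x \<notin> \<int>"
  shows "content_ratio (l(i := Suc (l i))) x =
    content_ratio l x * (1 - 1 / (x + of_nat i - of_nat (l i)))"
proof -
  obtain k where k: "\<And>i. i \<ge> k \<Longrightarrow> l i = 0" using partitions_bounded[OF assms(1)] by blast
  define K where "K = max k (Suc i)"
  let ?f = "\<lambda>l i. (x + of_nat i - of_nat (l i)) / (x + of_nat i)"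
  have "content_ratio (l(i := Suc (l i))) x = (\<Prod>j<K. ?f (l(i := Suc (l i))) j)"
    by (rule content_ratio_eq_prod) (use k assms in \<open>auto simp: K_def\<close>)
  also have "\<dots> = ?f (l(i := Suc (l i))) i * (\<Prod>j\<in>{..<K} - {i}. ?f (l(i := Suc (l i))) j)"
    by (rule prod.remove) (auto simp: K_def)
  also have "(\<Prod>j\<in>{..<K} - {i}. ?f (l(i := Suc (l i))) j) = (\<Prod>j\<in>{..<K} - {i}. ?f l j)"
    by (rule prod.cong) auto
  also have "?f (l(i := Suc (l i))) i = (1 - 1 / (x + of_nat i - of_nat (l i))) * ?f l i"
    using not_Ints_shift(1,2)[OF assms(2)] by (simp add: divide_simps)
  finally have "content_ratio (l(i := Suc (l i))) x =
      (1 - 1 / (x + of_nat i - of_nat (l i))) * (?f l i * (\<Prod>j\<in>{..<K} - {i}. ?f l j))"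
    by (simp only: mult.assoc)
  also have "?f l i * (\<Prod>j\<in>{..<K} - {i}. ?f l j) = (\<Prod>j<K. ?f l j)"
    by (rule prod.remove[symmetric]) (auto simp: K_def)
  also have "\<dots> = content_ratio l x"
    by (rule content_ratio_eq_prod[symmetric]) (use k assms in \<open>auto simp: K_def\<close>)
  finally show ?thesis by (simp only: mult.commute)
qed

text \<open>The quotients of the new weights by \<open>pweight l\<close> are Kerov's transition
  probabilities. The first claim says that their total mass is 1, the second gives their Cauchy
  transform in the contents. Both evaluate the same partial fraction expansion, at
  \<open>w = -1\<close> and at \<open>w = x + of_nat k\<close>.\<close>

lemma sum_addable_pweight:
  fixes x :: "'a::field_char_0"
  assumes l: "l \<in> partitions"
  shows "(\<Sum>i\<in>addable l. pweight (l(i := Suc (l i)))) = (pweight l :: 'a)"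
    and "x \<notin> \<int> \<Longrightarrow>
      (\<Sum>i\<in>addable l. pweight (l(i := Suc (l i))) * (1 / (x + of_nat i - of_nat (l i)))) * content_ratio l x =
        pweight l * content_ratio l (x + 1) / x"
proof -
  obtain k where k: "\<And>i. i \<ge> k \<Longrightarrow> l i = 0" using partitions_bounded[OF l] by blast
  define b where "b = (\<lambda>i. of_nat (beta (Suc k) l i) :: 'a)"
  define q where "q i = (\<Prod>j\<in>{..<Suc k} - {i}. (b i + 1 - b j) / (b i - b j))" for i
  have inj: "inj_on b {..<Suc k}"
    unfolding b_def using l by (intro inj_on_of_nat_beta) (simp add: partitions_def)
  have bk: "b k = 0" using k[of k] by (simp add: b_def beta_def)
  have b1: "b i + 1 \<noteq> 0" for i unfolding b_def by (metis add.commute of_nat_Suc of_nat_neq_0)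
  then have b1': "-1 \<noteq> b i" for i by (metis add.commute add.right_inverse)
  have PF: "(\<Prod>j<Suc k. (w + 1 - b j) / (w - b j)) = 1 + (\<Sum>i<Suc k. q i / (w - b i))"
    if "w \<notin> b ` {..<Suc k}" for w
    using partial_fractions_shift[OF _ inj that, of 1] by (simp add: q_def)
  \<comment> \<open>At \<open>w = -1\<close> the factor of the empty row \<open>k\<close> vanishes
    because \<open>b k = 0\<close>; the expansion then yields the total mass.\<close>
  have "(\<Prod>j<Suc k. (-1 + 1 - b j) / (-1 - b j)) = 0"
    by (intro prod_zero bexI[of _ k]) (auto simp: bk)
  moreover have "-1 \<notin> b ` {..<Suc k}" using b1' by auto
  ultimately have "1 + (\<Sum>i<Suc k. q i / (-1 - b i)) = 0" using PF[of "-1"] by metis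
  moreover have "q i / (-1 - b i) = - (q i / (b i + 1))" for i
    by (metis add.commute minus_add_distrib minus_divide_right uminus_add_conv_diff)
  ultimately have total: "(\<Sum>i<Suc k. q i / (b i + 1)) = 1"
    by (simp add: sum_negf del: sum.lessThan_Suc)
  have "(\<Sum>i\<in>addable l. pweight (l(i := Suc (l i))) * 1) = pweight l * (\<Sum>i<Suc k. q i / (b i + 1) * 1)"
    unfolding q_def b_def by (rule sum_addable[OF l k])
  then show "(\<Sum>i\<in>addable l. pweight (l(i := Suc (l i)))) = (pweight l :: 'a)"
    using total by simp
  assume x: "x \<notin> \<int>"
  note nz = not_Ints_shift[OF x]
  \<comment> \<open>With this shift \<open>w - b i\<close> is \<open>x\<close> minus the content of
    the box to be added in row \<open>i\<close>.\<close>
  define w where "w = x + of_nat k"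
  have wb: "x + of_nat i - of_nat (l i) = w - b i" if "i < Suc k" for i
  proof -
    have "beta (Suc k) l i + i = l i + k" using that by (simp add: beta_def)
    then have "b i + of_nat i = of_nat (l i) + of_nat k" unfolding b_def by (metis of_nat_add)
    then show ?thesis by (simp add: w_def algebra_simps)
  qed
  have wb0: "w - b i \<noteq> 0" if "i < Suc k" for i using wb[OF that] nz(2)[of i "l i"] by metis
  have w1: "w + 1 \<noteq> 0" using nz(1)[of "Suc k"] by (simp add: w_def add_ac)
  have "(\<Sum>i\<in>addable l. pweight (l(i := Suc (l i))) * (1 / (x + of_nat i - of_nat (l i)))) =
     pweight l * (\<Sum>i<Suc k. q i / (b i + 1) * (1 / (x + of_nat i - of_nat (l i))))"
    unfolding q_def b_def by (rule sum_addable[OF l k])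
  \<comment> \<open>Split by \<open>(w - b i) + (b i + 1) = w + 1\<close>. The total mass 1 then
    supplies the constant term of the expansion at \<open>w\<close>.\<close>
  also have "(\<Sum>i<Suc k. q i / (b i + 1) * (1 / (x + of_nat i - of_nat (l i)))) =
      (\<Sum>i<Suc k. (q i / (w - b i) + q i / (b i + 1)) / (w + 1))"
  proof (rule sum.cong[OF refl])
    fix i assume "i \<in> {..<Suc k}"
    then have i: "i < Suc k" by simp
    show "q i / (b i + 1) * (1 / (x + of_nat i - of_nat (l i))) =
        (q i / (w - b i) + q i / (b i + 1)) / (w + 1)"
      unfolding wb[OF i] using wb0[OF i] w1 b1[of i]
      by (simp add: divide_simps) (simp add: algebra_simps)
  qed
  also have "\<dots> = (\<Prod>j<Suc k. (w + 1 - b j) / (w - b j)) / (w + 1)"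
  proof -
    have "w \<notin> b ` {..<Suc k}" using wb0 by fastforce
    from PF[OF this] total show ?thesis
      by (simp only: sum_divide_distrib[symmetric] sum.distrib add.commute)
  qed
  finally have S: "(\<Sum>i\<in>addable l. pweight (l(i := Suc (l i))) * (1 / (x + of_nat i - of_nat (l i)))) =
     pweight l * ((\<Prod>j<Suc k. (w + 1 - b j) / (w - b j)) / (w + 1))" .
  have F0: "content_ratio l x = (\<Prod>i<Suc k. (w - b i) / (x + of_nat i))"
    by (subst content_ratio_eq_prod[of "Suc k"]) (use k x wb in auto)
  have F1: "content_ratio l (x + 1) = (\<Prod>i<Suc k. (w + 1 - b i) / (x + 1 + of_nat i))"
  proof -
    have "content_ratio l (x + 1) =
        (\<Prod>i<Suc k. (x + 1 + of_nat i - of_nat (l i)) / (x + 1 + of_nat i))"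
      by (rule content_ratio_eq_prod) (use k nz in auto)
    also have "\<dots> = (\<Prod>i<Suc k. (w + 1 - b i) / (x + 1 + of_nat i))"
    proof (rule prod.cong[OF refl])
      fix i assume "i \<in> {..<Suc k}"
      then have "x + 1 + of_nat i - of_nat (l i) = w + 1 - b i"
        using wb[of i] by (simp add: algebra_simps)
      then show "(x + 1 + of_nat i - of_nat (l i)) / (x + 1 + of_nat i) =
         (w + 1 - b i) / (x + 1 + of_nat i)" by simp
    qed
    finally show ?thesis .
  qed
  \<comment> \<open>Compares the denominators at \<open>x + 1\<close> with those at
    \<open>x\<close>; the surplus factor \<open>x + of_nat (Suc k)\<close> is
    \<open>w + 1\<close>.\<close>
  have tele: "x * (\<Prod>i<n. x + 1 + of_nat i) = (\<Prod>i<n. x + of_nat i) * (x + of_nat n)" for n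
  proof (induction n)
    case (Suc n)
    have "x * (\<Prod>i<Suc n. x + 1 + of_nat i) = (x * (\<Prod>i<n. x + 1 + of_nat i)) * (x + of_nat (Suc n))"
      by (simp add: mult.assoc add_ac)
    then show ?case by (simp add: Suc.IH)
  qed simp
  have "(\<Prod>j<Suc k. (w + 1 - b j) / (w - b j)) / (w + 1) * content_ratio l x =
     (\<Prod>j<Suc k. (w + 1 - b j) / (w - b j) * ((w - b j) / (x + of_nat j))) / (w + 1)"
    unfolding F0 prod.distrib by (rule times_divide_eq_left)
  also have "(\<Prod>j<Suc k. (w + 1 - b j) / (w - b j) * ((w - b j) / (x + of_nat j))) =
      (\<Prod>j<Suc k. (w + 1 - b j) / (x + of_nat j))"
    by (rule prod.cong) (use wb0 in auto)
  also have "\<dots> / (w + 1) = (\<Prod>j<Suc k. w + 1 - b j) / ((\<Prod>j<Suc k. x + of_nat j) * (x + of_nat (Suc k)))"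
    by (simp add: prod_dividef w_def add_ac)
  also have "\<dots> = (\<Prod>j<Suc k. w + 1 - b j) / (x * (\<Prod>i<Suc k. x + 1 + of_nat i))"
    by (simp only: tele)
  also have "\<dots> = content_ratio l (x + 1) / x"
    unfolding F1 by (simp only: prod_dividef divide_divide_eq_left mult.commute)
  finally have Q: "(\<Prod>j<Suc k. (w + 1 - b j) / (w - b j)) / (w + 1) * content_ratio l x =
     content_ratio l (x + 1) / x" .
  show "(\<Sum>i\<in>addable l. pweight (l(i := Suc (l i))) * (1 / (x + of_nat i - of_nat (l i)))) * content_ratio l x =
        pweight l * content_ratio l (x + 1) / x"
    unfolding S mult.assoc Q by (rule times_divide_eq_right)
qed

definition plancherel_sum :: "nat \<Rightarrow> 'a::field_char_0 \<Rightarrow> 'a" where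
  "plancherel_sum n x = (\<Sum>l | l \<in> partitions \<and> psize l = n. (pweight l)\<^sup>2 * content_ratio l x)"

text \<open>Double counting of the edges of Young's lattice between sizes \<open>n\<close> and
  \<open>Suc n\<close>. The summand \<open>g\<close> sees both ends of the edge and the row of the
  box.\<close>

lemma sum_corners_eq_sum_addable:
  fixes g :: "(nat \<Rightarrow> nat) \<Rightarrow> (nat \<Rightarrow> nat) \<Rightarrow> nat \<Rightarrow> 'a::comm_monoid_add"
  shows "(\<Sum>m | m \<in> partitions \<and> psize m = Suc n. \<Sum>i\<in>corners m. g m (m(i := m i - 1)) i) =
         (\<Sum>l | l \<in> partitions \<and> psize l = n. \<Sum>i\<in>addable l. g (l(i := Suc (l i))) l i)"
proof -
  have fin: "finite (addable l)" if l: "l \<in> partitions" for l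
  proof -
    obtain k where "\<And>i. i \<ge> k \<Longrightarrow> l i = 0" using partitions_bounded[OF l] by blast
    then have "addable l \<subseteq> {..k}" using addable_bound[of _ l k] by auto
    then show ?thesis by (rule finite_subset) simp
  qed
  have psize_remove: "psize (m(i := m i - Suc 0)) = n"
    if "psize m = Suc n" "0 < m i" "m(i := m i - Suc 0) \<in> partitions" for m i
    using psize_remove_corner[of i m] that by (simp add: corners_def)
  have "(\<Sum>m | m \<in> partitions \<and> psize m = Suc n. \<Sum>i\<in>corners m. g m (m(i := m i - 1)) i) =
      (\<Sum>(m, i)\<in>(SIGMA m:{m. m \<in> partitions \<and> psize m = Suc n}. corners m). g m (m(i := m i - 1)) i)"
    by (rule sum.Sigma) (use finite_partitions_psize finite_corners in auto)
  also have "\<dots> = (\<Sum>(l, i)\<in>(SIGMA l:{l. l \<in> partitions \<and> psize l = n}. addable l).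
      g (l(i := Suc (l i))) l i)"
    by (rule sum.reindex_bij_witness[where
          i = "\<lambda>(l, i). (l(i := Suc (l i)), i)" and j = "\<lambda>(m, i). (m(i := m i - 1), i)"])
       (auto simp: corners_def addable_def psize_add_box psize_remove)
  also have "\<dots> = (\<Sum>l | l \<in> partitions \<and> psize l = n. \<Sum>i\<in>addable l. g (l(i := Suc (l i))) l i)"
    by (rule sum.Sigma[symmetric]) (use finite_partitions_psize fin in auto)
  finally show ?thesis .
qed

text \<open>Branching replaces one of the two weights of the larger partition by a sum over its
  corners. Regrouping the edges by the smaller partition leaves sums against the transition
  measure.\<close>

lemma plancherel_sum_Suc:
  fixes x :: "'a::field_char_0"
  assumes x: "x \<notin> \<int>"
  shows "of_nat (Suc n) * plancherel_sum (Suc n) x =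
           plancherel_sum n x - plancherel_sum n (x + 1) / x"
proof -
  have "of_nat (Suc n) * plancherel_sum (Suc n) x =
    (\<Sum>m | m \<in> partitions \<and> psize m = Suc n. \<Sum>i\<in>corners m.
       pweight m * pweight (m(i := m i - 1)) * content_ratio m x)"
    unfolding plancherel_sum_def sum_distrib_left
  proof (rule sum.cong[OF refl])
    fix m assume "m \<in> {m. m \<in> partitions \<and> psize m = Suc n}"
    then have "(\<Sum>i\<in>corners m. pweight (m(i := m i - 1))) = (of_nat (Suc n) * pweight m :: 'a)"
      using pweight_branching[of m n] by blast
    then show "of_nat (Suc n) * ((pweight m)\<^sup>2 * content_ratio m x) =
       (\<Sum>i\<in>corners m. pweight m * pweight (m(i := m i - 1)) * content_ratio m x)"
      by (simp only: sum_distrib_left[symmetric] sum_distrib_right[symmetric])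
         (simp only: power2_eq_square mult_ac)
  qed
  also have "\<dots> = (\<Sum>l | l \<in> partitions \<and> psize l = n. \<Sum>i\<in>addable l.
       pweight (l(i := Suc (l i))) * pweight l * content_ratio (l(i := Suc (l i))) x)"
    by (rule sum_corners_eq_sum_addable)
  also have "\<dots> = (\<Sum>l | l \<in> partitions \<and> psize l = n.
      (pweight l)\<^sup>2 * content_ratio l x - (pweight l)\<^sup>2 * content_ratio l (x + 1) / x)"
  proof (rule sum.cong[OF refl])
    fix l assume "l \<in> {l. l \<in> partitions \<and> psize l = n}"
    then have l: "l \<in> partitions" by simp
    let ?p = "\<lambda>i. pweight (l(i := Suc (l i))) :: 'a"
    let ?S = "\<Sum>i\<in>addable l. ?p i * (1 / (x + of_nat i - of_nat (l i)))"
    \<comment> \<open>The new box contributes \<open>1 - 1 / (x - c)\<close>; its two parts lead to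
      the total mass and the Cauchy transform.\<close>
    have "(\<Sum>i\<in>addable l. ?p i * pweight l * content_ratio (l(i := Suc (l i))) x) =
        (\<Sum>i\<in>addable l. pweight l * content_ratio l x * ?p i -
            pweight l * content_ratio l x * (?p i * (1 / (x + of_nat i - of_nat (l i)))))"
      by (rule sum.cong) (simp_all add: content_ratio_add_box[OF l x] algebra_simps)
    also have "\<dots> = pweight l * content_ratio l x * (\<Sum>i\<in>addable l. ?p i) - pweight l * (?S * content_ratio l x)"
      by (simp only: sum_subtractf sum_distrib_left[symmetric] mult_ac)
    also have "\<dots> = (pweight l)\<^sup>2 * content_ratio l x - (pweight l)\<^sup>2 * content_ratio l (x + 1) / x"
      unfolding sum_addable_pweight(1)[OF l] sum_addable_pweight(2)[OF l x]
      by (simp add: power2_eq_square mult_ac)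
    finally show "(\<Sum>i\<in>addable l. ?p i * pweight l * content_ratio (l(i := Suc (l i))) x) = \<dots>" .
  qed
  finally show ?thesis by (simp add: plancherel_sum_def sum_subtractf sum_divide_distrib)
qed

lemma plancherel_sum_0:
  assumes "x \<notin> \<int>"
  shows "plancherel_sum 0 x = 1"
proof -
  have "(\<lambda>_. 0) \<in> partitions" "psize (\<lambda>_. 0) = 0"
    by (simp_all add: partitions_def psize_def monotone_def)
  then have "{l. l \<in> partitions \<and> psize l = 0} = {\<lambda>_. 0}"
    using partition_psize_0 by fastforce
  moreover have "content_ratio (\<lambda>_. 0) x = 1"
    using assms by (simp add: content_ratio_eq_prod[of 0])
  ultimately show ?thesis
    by (simp add: plancherel_sum_def pweight_def pdim_empty psize_def)
qed

text \<open>Induction on \<open>n\<close>: the recursion is applied at \<open>x\<close> and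
  \<open>x - 1\<close>, the induction hypothesis at \<open>x\<close> and \<open>x + 1\<close>, and
  the recursion one level lower at \<open>x + 1\<close> closes the computation.\<close>

lemma plancherel_sum_difference:
  fixes x :: "'a::field_char_0"
  assumes "x \<notin> \<int>"
  shows "x * (x - 1) * (plancherel_sum n x - plancherel_sum n (x - 1)) =
           (case n of 0 \<Rightarrow> 0 | Suc m \<Rightarrow> plancherel_sum m (x + 1))"
  using assms
proof (induction n arbitrary: x)
  case 0
  then show ?case using not_Ints_shift(4)[OF 0] by (simp add: plancherel_sum_0)
next
  case (Suc n)
  note nI = not_Ints_shift(3,4)[OF Suc.prems]
  have nz: "x \<noteq> 0" "x - 1 \<noteq> 0" "x + 1 \<noteq> 0"
    using Suc.prems nI not_Ints_shift(1)[OF Suc.prems, of 1] by auto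
  \<comment> \<open>The right side of the induction hypothesis, set to zero for \<open>n = 0\<close>
    so that the smallest case needs no separate treatment.\<close>
  define B where "B y = (case n of 0 \<Rightarrow> 0 | Suc m \<Rightarrow> plancherel_sum m y)" for y :: 'a
  let ?A = "plancherel_sum n"
  have B: "B (x + 1) - B (x + 1 + 1) / (x + 1) = of_nat n * ?A (x + 1)"
  proof (cases n)
    case (Suc m)
    then show ?thesis using plancherel_sum_Suc[OF nI(1), of m] by (simp add: B_def)
  qed (simp add: B_def)
  have D0: "x * (x - 1) * (?A x - ?A (x - 1)) = B (x + 1)"
    using Suc.IH[OF Suc.prems] by (simp add: B_def)
  have D1: "(x + 1) * x * (?A (x + 1) - ?A x) = B (x + 1 + 1)"
    using Suc.IH[OF nI(1)] by (simp only: B_def add_diff_cancel_right')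
  have "x * (x - 1) * (of_nat (Suc n) * plancherel_sum (Suc n) x -
          of_nat (Suc n) * plancherel_sum (Suc n) (x - 1)) =
        x * (x - 1) * (?A x - ?A (x + 1) / x - (?A (x - 1) - ?A x / (x - 1)))"
    unfolding plancherel_sum_Suc[OF Suc.prems] plancherel_sum_Suc[OF nI(2)] by simp
  \<comment> \<open>Regrouped so that only the differences governed by \<open>D0\<close> and
    \<open>D1\<close> and one value at \<open>x + 1\<close> remain.\<close>
  also have "\<dots> = x * (x - 1) * (?A x - ?A (x - 1)) + ?A (x + 1) - x * (?A (x + 1) - ?A x)"
    using nz by (simp add: field_simps)
  also have "x * (?A (x + 1) - ?A x) = B (x + 1 + 1) / (x + 1)"
    unfolding D1[symmetric] using nz by (simp add: field_simps)
  also have "x * (x - 1) * (?A x - ?A (x - 1)) + ?A (x + 1) - B (x + 1 + 1) / (x + 1) =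
      of_nat (Suc n) * ?A (x + 1)"
    unfolding D0 using B by (simp add: algebra_simps)
  finally have "of_nat (Suc n) * (x * (x - 1) * (plancherel_sum (Suc n) x - plancherel_sum (Suc n) (x - 1))) =
      of_nat (Suc n) * ?A (x + 1)"
    by (simp only: right_diff_distrib mult.left_commute)
  then show ?case by (simp del: of_nat_Suc)
qed

section \<open>Rational functions\<close>

text \<open>Allows \<open>plancherel_sum\<close> and its identities to be used with \<open>x\<close>
  in the field of rational functions.\<close>

instance fract :: ("{idom,ring_char_0}") field_char_0
proof
  show "inj (of_nat :: nat \<Rightarrow> 'a fract)"
    by (rule injI) (simp add: of_nat_fract eq_fract)
qed

section \<open>The shift as a field endomorphism\<close>

lemma pcompose_shift_nonzero: "q \<noteq> 0 \<Longrightarrow> pcompose q [:c::'a::field, 1:] \<noteq> 0"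
  using pcompose_eq_0[of q "[:c, 1:]"] by auto

lemma rat_shift_1 [simp]: "rat_shift c 1 = 1"
  by (simp add: One_fract_def rat_shift_Fract pcompose_1)

lemma rat_shift_0 [simp]: "rat_shift c 0 = 0"
  by (simp add: Zero_fract_def rat_shift_Fract pcompose_1)

lemma rat_shift_add: "rat_shift c (f + g) = rat_shift c f + rat_shift c g"
proof (cases f, cases g)
  fix p q r s :: "'a poly" assume "f = Fract p q" "q \<noteq> 0" "g = Fract r s" "s \<noteq> 0"
  then show ?thesis
    by (simp add: rat_shift_Fract pcompose_shift_nonzero pcompose_add pcompose_mult)
qed

lemma rat_shift_mult: "rat_shift c (f * g) = rat_shift c f * rat_shift c g"
proof (cases f, cases g)
  fix p q r s :: "'a poly" assume "f = Fract p q" "q \<noteq> 0" "g = Fract r s" "s \<noteq> 0"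
  then show ?thesis
    by (simp add: rat_shift_Fract pcompose_mult)
qed

lemma rat_shift_diff: "rat_shift c (f - g) = rat_shift c f - rat_shift c g"
  using rat_shift_add[of c "f - g" g] by simp

lemma rat_shift_divide: "rat_shift c (f / g) = rat_shift c f / rat_shift c g"
proof (cases "g = 0")
  case False
  have "rat_shift c g * rat_shift c (1 / g) = 1"
    using False by (simp flip: rat_shift_mult)
  then have "rat_shift c (1 / g) = 1 / rat_shift c g" by (metis inverse_eq_divide inverse_unique)
  then show ?thesis using rat_shift_mult[of c f "1 / g"] by simp
qed simp

lemma rat_shift_of_nat [simp]: "rat_shift c (of_nat n) = of_nat n"
  by (induction n) (simp_all add: rat_shift_add)

lemma rat_shift_power: "rat_shift c (f ^ n) = rat_shift c f ^ n"
  by (induction n) (simp_all add: rat_shift_mult)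

lemma rat_shift_sum: "rat_shift c (sum f A) = (\<Sum>x\<in>A. rat_shift c (f x))"
  by (induction A rule: infinite_finite_induct) (simp_all add: rat_shift_add)

lemma rat_shift_prod: "rat_shift c (prod f A) = (\<Prod>x\<in>A. rat_shift c (f x))"
  by (induction A rule: infinite_finite_induct) (simp_all add: rat_shift_mult)

lemma rat_shift_ratconst [simp]: "rat_shift c (ratconst d) = ratconst d"
  by (simp add: ratconst_def to_fract_def rat_shift_Fract pcompose_1)

lemma rat_shift_ratX: "rat_shift c ratX = ratX + ratconst c"
  by (simp add: ratX_def ratconst_def to_fract_def rat_shift_Fract pcompose_1 pcompose_pCons)

lemma rat_shift_pweight [simp]:
  "rat_shift c (pweight l :: 'a::field_char_0 poly fract) = pweight l"
proof -
  have "rat_shift c (fact (psize l) :: 'a poly fract) = fact (psize l)"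
    by (metis of_nat_fact rat_shift_of_nat)
  then show ?thesis by (simp add: pweight_def rat_shift_divide)
qed

text \<open>The weights are rational constants, so the shift acts only on \<open>x\<close>.
  Non-integrality before and after the shift turns both infinite products into products over the
  same rows.\<close>

lemma rat_shift_plancherel_sum:
  fixes x :: "'a::field_char_0 poly fract"
  assumes "x \<notin> \<int>" "rat_shift c x \<notin> \<int>"
  shows "rat_shift c (plancherel_sum n x) = plancherel_sum n (rat_shift c x)"
proof -
  have "rat_shift c (content_ratio l x) = content_ratio l (rat_shift c x)" if l: "l \<in> partitions" for l
  proof -
    obtain k where k: "\<And>i. i \<ge> k \<Longrightarrow> l i = 0" using partitions_bounded[OF l] by blast
    show ?thesis
      using content_ratio_eq_prod[of k l x] content_ratio_eq_prod[of k l "rat_shift c x"] k assms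
      by (simp add: rat_shift_prod rat_shift_divide rat_shift_diff rat_shift_add)
  qed
  then show ?thesis
    by (simp add: plancherel_sum_def rat_shift_sum rat_shift_mult rat_shift_power)
qed

section \<open>The embedding of constants\<close>

lemma ratconst_mult: "ratconst (a * b) = ratconst a * ratconst b"
  by (simp add: ratconst_def flip: to_fract_mult)

lemma ratconst_1 [simp]: "ratconst 1 = 1"
  by (simp add: ratconst_def flip: one_pCons)

lemma ratconst_eq_0_iff [simp]: "ratconst a = 0 \<longleftrightarrow> a = 0"
  by (simp add: ratconst_def)

lemma ratconst_diff: "ratconst (a - b) = ratconst a - ratconst b"
  by (simp add: ratconst_def flip: to_fract_diff)

lemma ratconst_minus: "ratconst (- a) = - ratconst a"
  by (simp add: ratconst_def flip: to_fract_uminus)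

lemma ratconst_power: "ratconst (a ^ n) = ratconst a ^ n"
  by (induction n) (simp_all add: ratconst_mult)

lemma ratconst_of_nat [simp]: "ratconst (of_nat n) = of_nat n"
  by (simp add: ratconst_def to_fract_def of_nat_fract of_nat_poly)

lemma ratconst_divide: "ratconst (a / b) = ratconst a / ratconst b"
proof (cases "b = 0")
  case False
  then have "ratconst (a / b) * ratconst b = ratconst a" by (simp flip: ratconst_mult)
  then show ?thesis using False by (simp add: nonzero_eq_divide_eq)
qed (simp add: ratconst_def)

lemma ratconst_pweight: "ratconst (of_nat (pdim l) / fact (psize l)) = pweight l"
proof -
  have "ratconst (fact (psize l) :: 'a) = fact (psize l)" by (metis of_nat_fact ratconst_of_nat)
  then show ?thesis by (simp add: pweight_def ratconst_divide)
qed

text \<open>Otherwise \<open>X\<close> would be a constant. This makes the identities for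
  non-integral \<open>x\<close> available at \<open>x = X / h\<close>.\<close>

lemma ratX_scaled_not_Ints:
  assumes "(h :: 'a::field_char_0) \<noteq> 0"
  shows "ratX / ratconst h \<notin> \<int>"
proof
  assume "ratX / ratconst h \<in> \<int>"
  then obtain m where m: "ratX / ratconst h = of_int m" by (elim Ints_cases)
  obtain a b where "m = int a - int b" by (rule int_diff_cases)
  with m have "ratX = ratconst ((of_nat a - of_nat b) * h)"
    using assms by (simp add: ratconst_mult ratconst_diff field_simps)
  then show False by (simp add: ratX_def ratconst_def)
qed

section \<open>The coefficients of the generating function\<close>

lemma Z4D_factor_scaled:
  assumes "(h :: 'a::field_char_0) \<noteq> 0"
  shows "Z4D_factor h l i =
    (ratX / ratconst h + of_nat i - of_nat (l i)) / (ratX / ratconst h + of_nat i)"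
proof -
  have h: "ratconst h \<noteq> 0" using assms by simp
  have 1: "ratX - ratconst ((of_nat (l i) - of_nat i) * h) =
     ratconst h * (ratX / ratconst h + of_nat i - of_nat (l i))"
    using h by (simp add: ratconst_mult ratconst_diff field_simps)
  have 2: "ratX - ratconst (- of_nat i * h) = ratconst h * (ratX / ratconst h + of_nat i)"
    using h by (simp add: ratconst_mult ratconst_minus field_simps)
  show ?thesis unfolding Z4D_factor_def 1 2 using h by simp
qed

lemma fps_nth_Z4D:
  assumes "(h :: 'a::field_char_0) \<noteq> 0"
  shows "fps_nth (Z4D h) n = plancherel_sum n (ratX / ratconst h) / ratconst h ^ (2 * n)"
proof -
  have nth: "fps_nth (Z4D_term h l) m =
     (if psize l = m then (pweight l)\<^sup>2 * content_ratio l (ratX / ratconst h) / ratconst h ^ (2 * m) else 0)"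
    for l m
  proof -
    have "Z4D_factor h l = (\<lambda>i. (ratX / ratconst h + of_nat i - of_nat (l i)) / (ratX / ratconst h + of_nat i))"
      using Z4D_factor_scaled[OF assms, of l] by (rule ext)
    then have "Prod_any (Z4D_factor h l) = content_ratio l (ratX / ratconst h)"
      by (simp only: content_ratio_def)
    moreover have "ratconst ((of_nat (pdim l) / fact (psize l))\<^sup>2 * (1 / h) ^ (2 * psize l)) =
        (pweight l)\<^sup>2 / ratconst h ^ (2 * psize l)"
      unfolding ratconst_mult ratconst_power ratconst_pweight
      by (simp add: ratconst_divide power_one_over)
    ultimately show ?thesis by (simp add: Z4D_term_def fps_X_power_mult_right_nth)
  qed
  define S where "S = Abs_fps (\<lambda>m. plancherel_sum m (ratX / ratconst h) / ratconst h ^ (2 * m))"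
  have fin: "finite {l \<in> partitions. fps_nth (Z4D_term h l) m \<noteq> 0}" for m
    by (rule finite_subset[OF _ finite_partitions_psize[of m]]) (auto simp: nth split: if_splits)
  have "(Z4D_term h has_sum S) partitions"
  proof (rule has_sum_fpsI[OF fin])
    fix m
    have "(\<Sum>l | l \<in> partitions \<and> fps_nth (Z4D_term h l) m \<noteq> 0. fps_nth (Z4D_term h l) m) =
        (\<Sum>l | l \<in> partitions \<and> psize l = m. fps_nth (Z4D_term h l) m)"
      by (rule sum.mono_neutral_left) (auto simp: finite_partitions_psize nth split: if_splits)
    also have "\<dots> = fps_nth S m"
      by (simp add: S_def plancherel_sum_def sum_divide_distrib nth)
    finally show "fps_nth S m =
        (\<Sum>l | l \<in> partitions \<and> fps_nth (Z4D_term h l) m \<noteq> 0. fps_nth (Z4D_term h l) m)" ..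
  qed
  \<comment> \<open>Limits are unique, so the series built from the coefficientwise sums is the
    infinite sum.\<close>
  then have "Z4D h = S"
    using Z4D_has_sum unfolding has_sum_def
    by (rule tendsto_unique[OF finite_subsets_at_top_neq_bot, rotated])
  then show ?thesis by (simp add: S_def)
qed

theorem theorem5:
  fixes h :: "'a::field_char_0"
  assumes "h \<noteq> 0"
  shows "fps_const (ratX - ratconst h) * (fps_rat_shift (- h) (Z4D h) - Z4D h) +
           fps_const (1 / ratX) * fps_X * fps_rat_shift h (Z4D h) = 0"
proof (rule fps_ext)
  fix n
  define H where "H = ratconst h"
  define x where "x = ratX / H"
  have H: "H \<noteq> 0" using assms by (simp add: H_def)
  have X: "ratX = H * x" using H by (simp add: x_def)
  have x: "x \<notin> \<int>" using ratX_scaled_not_Ints[OF assms] by (simp add: x_def H_def)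
  note xI = not_Ints_shift(3,4)[OF x]
  have x0: "x \<noteq> 0" "x - 1 \<noteq> 0" using x xI by auto
  have sh: "rat_shift h x = x + 1" "rat_shift (- h) x = x - 1"
    using H by (simp_all add: x_def H_def rat_shift_divide rat_shift_ratX ratconst_minus add_divide_distrib diff_divide_distrib)
  have Z: "fps_nth (Z4D h) m = plancherel_sum m x / H ^ (2 * m)" for m
    by (simp add: fps_nth_Z4D[OF assms] x_def H_def)
  have shH: "rat_shift c H = H" for c by (simp add: H_def)
  have Zp: "rat_shift h (fps_nth (Z4D h) m) = plancherel_sum m (x + 1) / H ^ (2 * m)" for m
    using rat_shift_plancherel_sum[OF x, of h m] xI
    by (simp add: Z sh rat_shift_divide rat_shift_power shH)
  have Zm: "rat_shift (- h) (fps_nth (Z4D h) m) = plancherel_sum m (x - 1) / H ^ (2 * m)" for m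
    using rat_shift_plancherel_sum[OF x, of "- h" m] xI
    by (simp add: Z sh rat_shift_divide rat_shift_power shH)
  \<comment> \<open>The difference equation divided by \<open>- x\<close>; the factor
    \<open>x - 1\<close> remains because \<open>X - h\<close> equals
    \<open>H * (x - 1)\<close>.\<close>
  have D: "(x - 1) * (plancherel_sum n (x - 1) - plancherel_sum n x) =
      - ((case n of 0 \<Rightarrow> 0 | Suc m \<Rightarrow> plancherel_sum m (x + 1)) / x)"
    using plancherel_sum_difference[OF x, of n] x0 by (simp add: field_simps)
  have "fps_nth (fps_const (ratX - ratconst h) * (fps_rat_shift (- h) (Z4D h) - Z4D h)) n =
      H * ((x - 1) * (plancherel_sum n (x - 1) - plancherel_sum n x)) / H ^ (2 * n)"
    by (simp add: fps_rat_shift_def Zm[unfolded Z] Z X flip: H_def) (simp add: algebra_simps diff_divide_distrib add_divide_distrib)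
  \<comment> \<open>Multiplication by \<open>fps_X\<close> lowers the index by one. The missing
    \<open>H ^ 2\<close> and \<open>1 / X = 1 / (H * x)\<close> combine to the factor
    \<open>H / x\<close>; for \<open>n = 0\<close> the coefficient is zero.\<close>
  moreover have "fps_nth (fps_const (1 / ratX) * fps_X * fps_rat_shift h (Z4D h)) n =
     H * ((case n of 0 \<Rightarrow> 0 | Suc m \<Rightarrow> plancherel_sum m (x + 1)) / x) / H ^ (2 * n)"
  proof (cases n)
    case (Suc m)
    have "fps_nth (fps_const (1 / ratX) * fps_X * fps_rat_shift h (Z4D h)) n =
        1 / ratX * (plancherel_sum m (x + 1) / H ^ (2 * m))"
      by (simp add: mult.assoc fps_rat_shift_def Suc flip: Zp)
    also have "\<dots> = H * (plancherel_sum m (x + 1) / x) / H ^ (2 * Suc m)"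
      using H by (simp add: X)
    finally show ?thesis by (simp add: Suc)
  qed (simp add: mult.assoc)
  ultimately show "fps_nth (fps_const (ratX - ratconst h) * (fps_rat_shift (- h) (Z4D h) - Z4D h) +
           fps_const (1 / ratX) * fps_X * fps_rat_shift h (Z4D h)) n = fps_nth 0 n"
    unfolding D by simp
qed

end
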